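(* For all positive integers $n \le m$ with $m \le 7n$, the divisor graph $G[n,m]$ is planar and $3$-colorable. Moreover, $7$ is the maximum of the set of all real numbers $r$ such that $G[n,\lfloor rn\rfloor]$ is planar for every positive integer $n$.
   Context: For positive integers $n,m$, $G[n,m]$ denotes the divisor graph on the set of integers $\{n,n+1,\ldots,m\}$: the simple graph whose vertex set is $\{n,n+1,\ldots,m\}$ (empty if $m<n$) and in which $u,v$ are adjacent if and only if $u\neq v$ and either $u\mid v$ or $v\mid u$. A graph is planar if it can be drawn in the plane without edge crossings, and $3$-colorable if its vertices can be colored with at most $3$ colors so that adjacent vertices receive different colors. *)

theory Defs
  imports "HOL-Analysis.Analysis"
begin

text \<open>
  A finite or infinite simple graph is given by its vertex set and its set of edges,
  an edge being the two-element set of its endpoints.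
\<close>

record 'a graph =
  verts :: "'a set"
  edges :: "'a set set"

definition simple_graph :: "'a graph \<Rightarrow> bool" where
  "simple_graph G \<longleftrightarrow> (\<forall>e\<in>edges G. e \<subseteq> verts G \<and> card e = 2)"

definition adjacent :: "'a graph \<Rightarrow> 'a \<Rightarrow> 'a \<Rightarrow> bool" where
  "adjacent G u v \<longleftrightarrow> {u, v} \<in> edges G"

text \<open>
  The plane is the type of complex numbers. Edges are drawn as arcs (injective paths)
  joining the images of their endpoints; an arc passes through no other vertex, and
  two distinct arcs meet only at the images of common endpoints.
\<close>

definition plane_drawing ::
    "'a graph \<Rightarrow> ('a \<Rightarrow> complex) \<Rightarrow> ('a set \<Rightarrow> real \<Rightarrow> complex) \<Rightarrow> bool" where
  "plane_drawing G p \<gamma> \<longleftrightarrow>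
     inj_on p (verts G) \<and>
     (\<forall>e\<in>edges G. arc (\<gamma> e) \<and> {pathstart (\<gamma> e), pathfinish (\<gamma> e)} = p ` e) \<and>
     (\<forall>e\<in>edges G. path_image (\<gamma> e) \<inter> p ` verts G = p ` e) \<and>
     (\<forall>e\<in>edges G. \<forall>f\<in>edges G. e \<noteq> f \<longrightarrow>
        path_image (\<gamma> e) \<inter> path_image (\<gamma> f) = p ` (e \<inter> f))"

definition planar :: "'a graph \<Rightarrow> bool" where
  "planar G \<longleftrightarrow> (\<exists>p \<gamma>. plane_drawing G p \<gamma>)"

definition colorable :: "nat \<Rightarrow> 'a graph \<Rightarrow> bool" where
  "colorable k G \<longleftrightarrow>
     (\<exists>c :: 'a \<Rightarrow> nat. (\<forall>v\<in>verts G. c v < k) \<and>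
        (\<forall>u\<in>verts G. \<forall>v\<in>verts G. adjacent G u v \<longrightarrow> c u \<noteq> c v))"

text \<open>
  Integers rather than naturals, so that a negative upper bound (as the floor of
  \<open>r * n\<close> for negative \<open>r\<close>) gives the empty graph without truncation.
\<close>

definition divisor_graph :: "int \<Rightarrow> int \<Rightarrow> int graph" where
  "divisor_graph n m =
     \<lparr>verts = {n..m},
      edges = {{u, v} | u v. u \<in> {n..m} \<and> v \<in> {n..m} \<and> u \<noteq> v \<and> (u dvd v \<or> v dvd u)}\<rparr>"

lemma verts_divisor_graph [simp]: "verts (divisor_graph n m) = {n..m}"
  by (simp add: divisor_graph_def)

lemma adjacent_divisor_graph_iff:
  "adjacent (divisor_graph n m) u v \<longleftrightarrow>
     u \<in> {n..m} \<and> v \<in> {n..m} \<and> u \<noteq> v \<and> (u dvd v \<or> v dvd u)"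
  by (auto simp: adjacent_def divisor_graph_def doubleton_eq_iff)

lemma simple_graph_divisor_graph: "simple_graph (divisor_graph n m)"
  by (auto simp: simple_graph_def divisor_graph_def)

end

theory Submission
  imports Defs "HOL-Analysis.Kronecker_Approximation_Theorem"
begin

text \<open>
  Send \<open>v = w * 2 ^ a * 3 ^ b * 5 ^ c\<close> with \<open>w\<close> coprime to 30 to the point \<open>(a - c, b - c)\<close>, with a
  separate sheet for every \<open>w\<close>. This identifies numbers differing by a power of 30, of which only
  one lies between \<open>n\<close> and \<open>7 * n\<close>, and turns multiplication by 2, 3, 5 and 6 into unit edges of a
  triangular lattice. Multiplication by 4 is a double step, which can be bent around its midpoint,
  and the only multiplication by 7 joins two different sheets, one of which can be turned inside
  out and put into a face of the other.

  For a ratio above 7, there is \<open>t = 2 ^ a / 3 ^ b\<close> slightly above 1, and the second edge from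
  \<open>t * n\<close> to \<open>7 * t * n\<close> yields a path between the far apart points \<open>n\<close> and \<open>t * n\<close> of a sheet
  through another sheet, which completes a subdivision of \<open>K\<close> with parts of size 3 and 3.
  Colour classes for the first part are \<open>v < 2 * n\<close>, \<open>2 * n \<le> v < 4 * n\<close> and \<open>4 * n \<le> v\<close>.
\<close>

section \<open>Theta graphs in plane drawings\<close>

text \<open>Drawings use arbitrary arcs, so non-planarity is proved for branch vertices that may be
  connected sets: \<open>u\<close>, \<open>h\<close>, \<open>V4\<close> against \<open>b1\<close>,
  \<open>b2\<close>, \<open>V3\<close>. Sets are needed because the chains starting from
  \<open>t * n\<close> depend on \<open>a\<close> and \<open>b\<close>, which cannot be bounded when
  \<open>t\<close> has to be close to 1; everything else is a fixed list of multiples of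
  \<open>q = 3 ^ (b - 2)\<close>. For the same reason the chains are kept off that list by
  divisibility (by 7, 256 and \<open>3 * q\<close>) and not by inspection.

  The choice \<open>n = 40 * 3 ^ b = 360 * q\<close> makes \<open>t * n = 40 * 2 ^ a\<close> and all
  fixed fractions of \<open>n\<close> integers. Closeness of \<open>t\<close> to 1 is used twice:
  \<open>7 * t * n\<close> must fit below the upper bound, and \<open>t < 6 / 5\<close> keeps
  \<open>5 * t * n\<close> below \<open>6 * n\<close>, where the chains live.

  For planarity, lattice positions stay distinct for every ratio below 30. The bound 7 serves to
  exclude crossings and to leave a single edge of quotient 7.\<close>

definition drawn :: "'a graph \<Rightarrow> ('a \<Rightarrow> complex) \<Rightarrow> ('a set \<Rightarrow> real \<Rightarrow> complex) \<Rightarrow> 'a set \<Rightarrow> complex set"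
  where "drawn G p \<gamma> X = p ` X \<union> (\<Union>e\<in>{e \<in> edges G. e \<subseteq> X}. path_image (\<gamma> e))"

definition connected_in :: "'a graph \<Rightarrow> 'a set \<Rightarrow> bool"
  where "connected_in G X \<longleftrightarrow>
    (\<forall>x\<in>X. \<forall>y\<in>X. (x, y) \<in> {(u, v). u \<in> X \<and> v \<in> X \<and> {u, v} \<in> edges G}\<^sup>*)"

text \<open>
  If the three paths of a theta graph could all be reached from the vertex \<open>z\<close> without
  crossing the other two, then the side \<open>U\<close> of \<open>c1 \<union> c2\<close> not containing \<open>z\<close> would miss \<open>K\<close>
  and lie on the side of \<open>z\<close> for the other two cycles, against Janiszewski's theorem.
\<close>

lemma theta_curve_separation:
  fixes c1 c2 :: "real \<Rightarrow> complex"
  assumes c1: "arc c1" "pathstart c1 = P" "pathfinish c1 = Q"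
    and c2: "arc c2" "pathstart c2 = Q" "pathfinish c2 = P"
    and c12: "path_image c1 \<inter> path_image c2 = {P, Q}"
    and K: "connected K" "compact (K \<union> {P, Q})" "connected (K \<union> {P, Q})"
      "K \<inter> (path_image c1 \<union> path_image c2) = {}"
    and Z1: "connected Z1" "z \<in> Z1" "b1 \<in> Z1" "b1 \<in> path_image c1"
      "Z1 \<inter> (path_image c2 \<union> (K \<union> {P, Q})) = {}"
    and Z2: "connected Z2" "z \<in> Z2" "b2 \<in> Z2" "b2 \<in> path_image c2"
      "Z2 \<inter> (path_image c1 \<union> (K \<union> {P, Q})) = {}"
    and Z3: "connected Z3" "z \<in> Z3" "b3 \<in> Z3" "b3 \<in> K"
      "Z3 \<inter> (path_image c1 \<union> path_image c2) = {}"
  shows False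
proof -
  define c where "c = c1 +++ c2"
  define S where "S = path_image c1 \<union> (K \<union> {P, Q})"
  define T where "T = path_image c2 \<union> (K \<union> {P, Q})"
  have "simple_path c"
    unfolding c_def using c1 c2 c12 by (intro simple_path_join_loop) auto
  moreover have "pathfinish c = pathstart c"
    using c1 c2 by (simp add: c_def)
  moreover have pc: "path_image c = path_image c1 \<union> path_image c2"
    using c1 c2 by (simp add: c_def path_image_join)
  ultimately obtain I O' where IO: "open I" "connected I" "open O'" "connected O'"
      "I \<inter> O' = {}" "I \<union> O' = - (path_image c1 \<union> path_image c2)"
      "frontier I = path_image c1 \<union> path_image c2"
      "frontier O' = path_image c1 \<union> path_image c2"
    using Jordan_curve by metis
  have zc: "z \<notin> path_image c1 \<union> path_image c2"
    using Z1 Z2 by blast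
  obtain U W where UW: "connected U" "open U" "open W" "U \<inter> W = {}"
      "U \<union> W = - (path_image c1 \<union> path_image c2)"
      "frontier U = path_image c1 \<union> path_image c2" "z \<in> W"
  proof (cases "z \<in> I")
    case True
    then show thesis using IO that[of O' I] by blast
  next
    case False
    then show thesis using IO that[of I O'] zc by blast
  qed
  have "connected (Z3 \<union> K)"
    using Z3 K by (intro connected_Un) auto
  moreover have "(Z3 \<union> K) \<inter> (path_image c1 \<union> path_image c2) = {}"
    using Z3 K by blast
  ultimately have "Z3 \<union> K \<subseteq> U \<or> Z3 \<union> K \<subseteq> W"
    using UW connectedD[of "Z3 \<union> K" U W] by blast
  then have UK: "U \<inter> K = {}"
    using UW Z3 by blast
  have PQ: "P \<in> path_image c1" "Q \<in> path_image c1" "P \<in> path_image c2" "Q \<in> path_image c2"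
    using c12 by auto
  have UST: "U \<inter> (S \<union> T) = {}"
    using UK UW PQ unfolding S_def T_def by blast
  have cS: "compact S" and cT: "compact T"
    unfolding S_def T_def by (intro compact_Un[OF compact_arc_image] c1 c2 K)+
  have ST: "S \<inter> T = K \<union> {P, Q}"
    using c12 unfolding S_def T_def by blast
  \<comment> \<open>\<open>U\<close> is entered from \<open>z\<close> through a small ball:
    \<open>Z\<close> leads from \<open>z\<close> to the frontier point \<open>b\<close>, and a ball
    about \<open>b\<close> that avoids the compact set \<open>R\<close> meets
    \<open>U\<close>.\<close>
  have reach: "connected_component (- R) z u"
    if R: "compact R" "U \<inter> R = {}" and Z: "connected Z" "z \<in> Z" "b \<in> Z" "b \<in> frontier U"
      "Z \<inter> R = {}" and u: "u \<in> U" for R Z b u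
  proof -
    have "open (- R)" "b \<in> - R"
      using R Z by (auto simp: compact_imp_closed open_Compl)
    then obtain e where e: "e > 0" "ball b e \<subseteq> - R"
      by (auto simp: open_contains_ball)
    have "b \<in> closure U"
      using Z by (simp add: frontier_def)
    then obtain y where y: "y \<in> U" "y \<in> ball b e"
      using e by (metis closure_approachable dist_commute mem_ball)
    have "connected (Z \<union> ball b e)"
      using Z e by (intro connected_Un) auto
    moreover have "(Z \<union> ball b e) \<inter> U \<noteq> {}"
      using y by blast
    ultimately have "connected (Z \<union> ball b e \<union> U)"
      using connected_Un UW(1) by blast
    moreover have "Z \<union> ball b e \<union> U \<subseteq> - R"
      using Z e R by auto
    ultimately show ?thesis
      using Z u unfolding connected_component_def by (intro exI[of _ "Z \<union> ball b e \<union> U"]) auto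
  qed
  have "b1 \<in> frontier U" "b2 \<in> frontier U"
    using UW Z1 Z2 by auto
  obtain u where u: "u \<in> U"
    using \<open>b1 \<in> frontier U\<close> by fastforce
  \<comment> \<open>Janiszewski applies since \<open>S \<inter> T = K \<union> {P, Q}\<close> is
    connected. The resulting connected set avoids both arcs, yet joins \<open>z\<close> in
    \<open>W\<close> to \<open>u\<close> in \<open>U\<close>.\<close>
  have "connected_component (- (S \<union> T)) z u"
  proof (rule Janiszewski)
    show "connected_component (- T) z u"
      using \<open>b1 \<in> frontier U\<close> Z1 cT UST u unfolding T_def by (intro reach[of _ Z1 b1]) auto
    show "connected_component (- S) z u"
      using \<open>b2 \<in> frontier U\<close> Z2 cS UST u unfolding S_def by (intro reach[of _ Z2 b2]) auto
  qed (use cS cT ST K compact_imp_closed in auto)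
  then obtain C where C: "connected C" "z \<in> C" "u \<in> C" "C \<subseteq> - (S \<union> T)"
    by (auto simp: connected_component_def)
  then have "C \<inter> (path_image c1 \<union> path_image c2) = {}"
    unfolding S_def T_def by blast
  then show False
    using C UW u connectedD[of C U W] by blast
qed

section \<open>Point sets drawn by sets of vertices\<close>

context
  fixes G :: "'a graph" and p \<gamma>
  assumes drw: "plane_drawing G p \<gamma>" and sg: "simple_graph G"
begin

lemma edge_arc: "e \<in> edges G \<Longrightarrow> arc (\<gamma> e)"
  using drw by (auto simp: plane_drawing_def)

lemma inj_positions: "inj_on p (verts G)"
  using drw by (auto simp: plane_drawing_def)

lemma edge_subset_verts: "e \<in> edges G \<Longrightarrow> e \<subseteq> verts G"
  using sg by (auto simp: simple_graph_def)

lemma edge_ends: "e \<in> edges G \<Longrightarrow> {pathstart (\<gamma> e), pathfinish (\<gamma> e)} = p ` e"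
  using drw by (auto simp: plane_drawing_def)

lemma edge_Int_verts: "e \<in> edges G \<Longrightarrow> path_image (\<gamma> e) \<inter> p ` verts G = p ` e"
  using drw by (auto simp: plane_drawing_def)

lemma edge_Int_edge:
  "e \<in> edges G \<Longrightarrow> f \<in> edges G \<Longrightarrow> e \<noteq> f \<Longrightarrow> path_image (\<gamma> e) \<inter> path_image (\<gamma> f) = p ` (e \<inter> f)"
  using drw by (auto simp: plane_drawing_def)

lemma edge_vertex_in: "e \<in> edges G \<Longrightarrow> u \<in> e \<Longrightarrow> p u \<in> path_image (\<gamma> e)"
  using edge_Int_verts by blast

lemma edge_Int_drawn:
  assumes e: "e \<in> edges G" "\<not> e \<subseteq> X" and X: "X \<subseteq> verts G"
  shows "path_image (\<gamma> e) \<inter> drawn G p \<gamma> X = p ` (e \<inter> X)"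
proof -
  have "path_image (\<gamma> e) \<inter> p ` X = p ` (e \<inter> X)"
  proof -
    have "path_image (\<gamma> e) \<inter> p ` X = p ` e \<inter> p ` X"
      using edge_Int_verts[OF e(1)] X by blast
    then show ?thesis
      using inj_on_image_Int[OF inj_positions, of e X] edge_subset_verts[OF e(1)] X by simp
  qed
  moreover have "path_image (\<gamma> e) \<inter> path_image (\<gamma> f) \<subseteq> p ` (e \<inter> X)"
    if f: "f \<in> edges G" "f \<subseteq> X" for f
  proof -
    have "e \<noteq> f" using e f by blast
    then show ?thesis using edge_Int_edge[OF e(1) f(1)] f(2) by blast
  qed
  ultimately show ?thesis
    unfolding drawn_def by blast
qed

lemma drawn_mono: "X \<subseteq> Y \<Longrightarrow> drawn G p \<gamma> X \<subseteq> drawn G p \<gamma> Y"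
  unfolding drawn_def by blast

lemma drawn_disjoint:
  assumes "X \<subseteq> verts G" "Y \<subseteq> verts G" "X \<inter> Y = {}"
  shows "drawn G p \<gamma> X \<inter> drawn G p \<gamma> Y = {}"
proof -
  have "p ` X \<inter> p ` Y = {}"
    using assms inj_on_image_Int[OF inj_positions, of X Y] by simp
  moreover have "path_image (\<gamma> e) \<inter> drawn G p \<gamma> B = {}"
    if e: "e \<in> edges G" "e \<subseteq> A" and AB: "A \<inter> B = {}" "B \<subseteq> verts G" for e A B
  proof -
    have "card e = 2" using e(1) sg by (auto simp: simple_graph_def)
    then have "e \<noteq> {}" by auto
    then have "\<not> e \<subseteq> B" using e AB by blast
    then have "path_image (\<gamma> e) \<inter> drawn G p \<gamma> B = p ` (e \<inter> B)"
      using edge_Int_drawn e AB by blast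
    also have "e \<inter> B = {}" using e AB by blast
    finally show ?thesis by simp
  qed
  note this[of _ X Y] this[of _ Y X]
  ultimately show ?thesis
    using assms unfolding drawn_def by blast
qed

lemma connected_edge: "e \<in> edges G \<Longrightarrow> connected (path_image (\<gamma> e))"
  by (simp add: edge_arc arc_imp_path connected_path_image)

text \<open>Serves to cut the edges attaching \<open>V3\<close> to the poles so that they miss the
  cycle. By injectivity of the arc, what remains is the image of a half-open interval.\<close>

lemma connected_half_edge:
  assumes e: "{u, v} \<in> edges G" "u \<noteq> v"
  shows "connected (path_image (\<gamma> {u, v}) - {p v})"
proof -
  let ?g = "\<gamma> {u, v}"
  have a: "arc ?g" using edge_arc e by blast
  have "p v \<in> {pathstart ?g, pathfinish ?g}"
    using edge_ends[OF e(1)] by auto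
  then consider "p v = pathstart ?g" | "p v = pathfinish ?g" by blast
  then show ?thesis
  proof cases
    case 1
    have "?g ` ({0..1} - {0}) = ?g ` {0..1} - ?g ` {0}"
      using arc_imp_inj_on[OF a] by (intro inj_on_image_set_diff[of _ "{0..1}"]) auto
    moreover have "{0..1} - {0} = ({0<..1} :: real set)" by auto
    ultimately have "path_image ?g - {p v} = ?g ` {0<..1}"
      using 1 by (simp add: path_image_def pathstart_def)
    moreover have "connected (?g ` {0<..1})"
      using arc_imp_path[OF a] unfolding path_def
      by (intro connected_continuous_image) (auto intro: continuous_on_subset)
    ultimately show ?thesis by simp
  next
    case 2
    have "?g ` ({0..1} - {1}) = ?g ` {0..1} - ?g ` {1}"
      using arc_imp_inj_on[OF a] by (intro inj_on_image_set_diff[of _ "{0..1}"]) auto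
    moreover have "{0..1} - {1} = ({0..<1} :: real set)" by auto
    ultimately have "path_image ?g - {p v} = ?g ` {0..<1}"
      using 2 by (simp add: path_image_def pathfinish_def)
    moreover have "connected (?g ` {0..<1})"
      using arc_imp_path[OF a] unfolding path_def
      by (intro connected_continuous_image) (auto intro: continuous_on_subset)
    ultimately show ?thesis by simp
  qed
qed

lemma connected_drawn:
  assumes "connected_in G X"
  shows "connected (drawn G p \<gamma> X)"
proof (cases "X = {}")
  case True
  have "drawn G p \<gamma> X = {}"
    using True sg by (auto simp: drawn_def simple_graph_def)
  then show ?thesis by simp
next
  case False
  then obtain x0 where x0: "x0 \<in> X" by blast
  let ?D = "drawn G p \<gamma> X"
  have edge: "connected_component ?D (p u) w"
    if "e \<in> edges G" "e \<subseteq> X" "u \<in> e" "w \<in> path_image (\<gamma> e)" for e u w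
    unfolding connected_component_def
    using that connected_edge edge_vertex_in[OF that(1,3)]
    by (intro exI[of _ "path_image (\<gamma> e)"]) (auto simp: drawn_def)
  have vert: "connected_component ?D (p x0) (p y)" if y: "y \<in> X" for y
  proof -
    have "(x0, y) \<in> {(u, v). u \<in> X \<and> v \<in> X \<and> {u, v} \<in> edges G}\<^sup>*"
      using assms x0 y by (auto simp: connected_in_def)
    then show ?thesis
    proof (induction rule: rtrancl_induct)
      case base
      then show ?case using x0 by (simp add: drawn_def)
    next
      case (step u v)
      then have "connected_component ?D (p u) (p v)"
        by (intro edge[of "{u, v}"]) (auto intro: edge_vertex_in)
      then show ?case using step.IH connected_component_trans by blast
    qed
  qed
  have "connected_component ?D (p x0) w" if w: "w \<in> ?D" for w
  proof -
    consider y where "y \<in> X" "w = p y"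
      | e where "e \<in> edges G" "e \<subseteq> X" "w \<in> path_image (\<gamma> e)"
      using w unfolding drawn_def by blast
    then show ?thesis
    proof cases
      case 1
      then show ?thesis using vert by blast
    next
      case 2
      then have "e \<noteq> {}" using sg by (auto simp: simple_graph_def)
      then obtain u where "u \<in> e" by blast
      then show ?thesis
        using 2 edge[of e u w] vert[of u] connected_component_trans by blast
    qed
  qed
  then show ?thesis
    unfolding connected_iff_connected_component
    by (meson connected_component_sym connected_component_trans)
qed

lemma compact_drawn:
  assumes "finite X"
  shows "compact (drawn G p \<gamma> X)"
proof -
  have "finite {e \<in> edges G. e \<subseteq> X}"
    by (rule finite_subset[of _ "Pow X"]) (use assms in auto)
  then show ?thesis
    unfolding drawn_def using assms
    by (intro compact_Un compact_UN) (auto simp: edge_arc compact_arc_image finite_imp_compact)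
qed

text \<open>Edges are prepended one at a time; a new edge meets the drawing of the later vertices
  only at the common vertex, so the arcs join. A single vertex is excluded because a point is not an
  arc.\<close>

lemma path_arc:
  assumes "vs \<noteq> []" "distinct (v # vs)" "successively (\<lambda>x y. {x, y} \<in> edges G) (v # vs)"
  shows "\<exists>g. arc g \<and> pathstart g = p v \<and> pathfinish g = p (last vs) \<and>
    p ` set (v # vs) \<subseteq> path_image g \<and> path_image g \<subseteq> drawn G p \<gamma> (set (v # vs))"
  using assms
proof (induction vs arbitrary: v)
  case Nil
  then show ?case by simp
next
  case (Cons w vs)
  have e: "{v, w} \<in> edges G" and vw: "v \<noteq> w" using Cons.prems by auto
  obtain h where h: "arc h" "pathstart h = p v" "pathfinish h = p w"
    "path_image h = path_image (\<gamma> {v, w})"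
  proof -
    have "{pathstart (\<gamma> {v, w}), pathfinish (\<gamma> {v, w})} = {p v, p w}"
      using edge_ends[OF e] by simp
    then consider "pathstart (\<gamma> {v, w}) = p v" "pathfinish (\<gamma> {v, w}) = p w"
      | "pathstart (\<gamma> {v, w}) = p w" "pathfinish (\<gamma> {v, w}) = p v"
      by (auto simp: doubleton_eq_iff)
    then show thesis
    proof cases
      case 1
      then show thesis using that[of "\<gamma> {v, w}"] edge_arc e by blast
    next
      case 2
      then show thesis using that[of "reversepath (\<gamma> {v, w})"] edge_arc e
        by (simp add: arc_reversepath)
    qed
  qed
  have hd: "path_image h \<subseteq> drawn G p \<gamma> (set (v # w # vs))"
    using h e unfolding drawn_def by auto
  have hv: "{p v, p w} \<subseteq> path_image h"
    using edge_vertex_in[OF e] h by auto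
  show ?case
  proof (cases "vs = []")
    case True
    then show ?thesis using h hd hv by (intro exI[of _ h]) auto
  next
    case False
    then obtain g where g: "arc g" "pathstart g = p w" "pathfinish g = p (last vs)"
      "p ` set (w # vs) \<subseteq> path_image g" "path_image g \<subseteq> drawn G p \<gamma> (set (w # vs))"
      using Cons.IH[of w] Cons.prems by auto
    have "set (w # vs) \<subseteq> verts G"
      using False Cons.prems(3)
    proof (induction vs arbitrary: w v)
      case Nil
      then show ?case by simp
    next
      case (Cons x xs)
      have "{w, x} \<subseteq> verts G"
        using Cons.prems edge_subset_verts by auto
      then show ?case
        using Cons.IH[of w x] Cons.prems by (cases xs) auto
    qed
    moreover have "\<not> {v, w} \<subseteq> set (w # vs)" "{v, w} \<inter> set (w # vs) = {w}"
      using Cons.prems by auto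
    ultimately have "path_image h \<inter> drawn G p \<gamma> (set (w # vs)) = {p w}"
      using edge_Int_drawn[OF e] h by auto
    then have "path_image h \<inter> path_image g \<subseteq> {p w}"
      using g by blast
    then have "arc (h +++ g)"
      using h g by (intro arc_join) auto
    moreover have "path_image (h +++ g) = path_image h \<union> path_image g"
      using h g by (simp add: path_image_join)
    moreover have "path_image g \<subseteq> drawn G p \<gamma> (set (v # w # vs))"
      using g(5) drawn_mono[of "set (w # vs)" "set (v # w # vs)"] by auto
    ultimately show ?thesis
      using h(2,3) g(2-4) False hd hv
      by (intro exI[of _ "h +++ g"] conjI) (simp_all, blast+)
  qed
qed

text \<open>An edge not contained in a vertex set meets the drawing of that set in vertices only, so
  no further common points arise.\<close>

lemma drawn_Int:
  assumes "X \<subseteq> verts G" "Y \<subseteq> verts G"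
  shows "drawn G p \<gamma> X \<inter> drawn G p \<gamma> Y = drawn G p \<gamma> (X \<inter> Y)"
proof
  show "drawn G p \<gamma> (X \<inter> Y) \<subseteq> drawn G p \<gamma> X \<inter> drawn G p \<gamma> Y"
    using drawn_mono[of "X \<inter> Y"] by blast
  have vv: "p ` A \<inter> p ` B \<subseteq> p ` (A \<inter> B)" if "A \<subseteq> verts G" "B \<subseteq> verts G" for A B
    using that inj_on_image_Int[OF inj_positions, of A B] by simp
  have ev: "path_image (\<gamma> e) \<inter> drawn G p \<gamma> B \<subseteq> drawn G p \<gamma> (A \<inter> B)"
    if e: "e \<in> edges G" "e \<subseteq> A" and B: "B \<subseteq> verts G" for e A B
  proof (cases "e \<subseteq> B")
    case True
    then show ?thesis using e unfolding drawn_def by blast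
  next
    case False
    have "p ` (e \<inter> B) \<subseteq> drawn G p \<gamma> (A \<inter> B)"
      using e unfolding drawn_def by blast
    then show ?thesis using edge_Int_drawn[OF e(1) False B] by blast
  qed
  show "drawn G p \<gamma> X \<inter> drawn G p \<gamma> Y \<subseteq> drawn G p \<gamma> (X \<inter> Y)"
  proof
    fix w assume w: "w \<in> drawn G p \<gamma> X \<inter> drawn G p \<gamma> Y"
    consider "w \<in> p ` X" "w \<in> p ` Y"
      | e where "e \<in> edges G" "e \<subseteq> X" "w \<in> path_image (\<gamma> e)"
      | e where "e \<in> edges G" "e \<subseteq> Y" "w \<in> path_image (\<gamma> e)"
      using w unfolding drawn_def by blast
    then show "w \<in> drawn G p \<gamma> (X \<inter> Y)"
    proof cases
      case 1
      then show ?thesis using vv[OF assms] unfolding drawn_def by blast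
    next
      case 2
      then show ?thesis using ev[of e X Y] assms w by blast
    next
      case 3
      then show ?thesis using ev[of e Y X] assms w by (auto simp: Int_commute)
    qed
  qed
qed

text \<open>A minor model of the complete bipartite graph with parts \<open>u\<close>,
  \<open>h\<close>, \<open>V4\<close> and \<open>b1\<close>, \<open>b2\<close>, \<open>V3\<close>:
  the poles \<open>u\<close>, \<open>h\<close> are joined by arcs through \<open>b1\<close> and
  \<open>b2\<close> and by a third way through \<open>V3\<close>, and the hub \<open>V4\<close>
  touches all three.\<close>

lemma no_theta_with_hub:
  assumes c1: "distinct (u # xs @ [h])" "successively (\<lambda>x y. {x, y} \<in> edges G) (u # xs @ [h])"
    and c2: "distinct (h # ys @ [u])" "successively (\<lambda>x y. {x, y} \<in> edges G) (h # ys @ [u])"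
    and c12: "set xs \<inter> set ys = {}" "{u, h} \<notin> edges G" "b1 \<in> set xs" "b2 \<in> set ys"
    and V3: "connected_in G V3" "finite V3" "{v, u} \<in> edges G" "{v', h} \<in> edges G" "v \<in> V3" "v' \<in> V3"
    and V4: "V4 \<noteq> {}" "connected_in G (insert b1 V4)" "connected_in G (insert b2 V4)"
      "connected_in G (V3 \<union> V4)"
    and V: "V3 \<inter> V4 = {}" "(V3 \<union> V4) \<inter> set (u # h # xs @ ys) = {}"
      "set (u # h # xs @ ys) \<subseteq> verts G" "V3 \<subseteq> verts G" "V4 \<subseteq> verts G"
  shows False
proof -
  let ?R = "drawn G p \<gamma>"
  let ?A = "set (u # xs @ [h])" and ?B = "set (h # ys @ [u])"
  obtain c1 where C1: "arc c1" "pathstart c1 = p u" "pathfinish c1 = p h"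
      "p ` ?A \<subseteq> path_image c1" "path_image c1 \<subseteq> ?R ?A"
    using path_arc[OF _ c1] by auto
  obtain c2 where C2: "arc c2" "pathstart c2 = p h" "pathfinish c2 = p u"
      "p ` ?B \<subseteq> path_image c2" "path_image c2 \<subseteq> ?R ?B"
    using path_arc[OF _ c2] by auto
  \<comment> \<open>The poles are removed from the two attaching edges so that \<open>K\<close>
    misses the cycle; adding them back makes it compact.\<close>
  define K where "K = ?R V3 \<union> (path_image (\<gamma> {v, u}) - {p u}) \<union> (path_image (\<gamma> {v', h}) - {p h})"
  have uv: "u \<noteq> v" "h \<noteq> v'" "u \<noteq> h" using V V3 c1 by auto
  have AB: "?A \<subseteq> verts G" "?B \<subseteq> verts G" "?A \<inter> ?B = {u, h}"
    using V c12 by auto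
  have "?R ?A \<inter> ?R ?B = ?R {u, h}"
    using drawn_Int[OF AB(1,2)] AB(3) by simp
  \<comment> \<open>Here \<open>{u, h} \<notin> edges G\<close> matters: \<open>drawn\<close> takes
    all induced edges, and this one would lie in both drawings.\<close>
  also have "\<dots> = {p u, p h}"
  proof -
    have "e = {u, h}" if "e \<in> edges G" "e \<subseteq> {u, h}" for e
      using that sg uv by (intro card_subset_eq) (auto simp: simple_graph_def)
    then have "{e \<in> edges G. e \<subseteq> {u, h}} = {}"
      using c12 by blast
    then show ?thesis unfolding drawn_def by (simp only: UN_empty) simp
  qed
  finally have RAB: "?R ?A \<inter> ?R ?B = {p u, p h}" .
  have pu: "p u \<in> path_image c1" "p h \<in> path_image c1" "p u \<in> path_image c2" "p h \<in> path_image c2"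
    using C1 C2 by auto
  have pv: "p v \<in> path_image (\<gamma> {v, u})" "p u \<in> path_image (\<gamma> {v, u})"
      "p v' \<in> path_image (\<gamma> {v', h})" "p h \<in> path_image (\<gamma> {v', h})"
    using V3 by (auto intro: edge_vertex_in)
  have pne: "p v \<noteq> p u" "p v' \<noteq> p h"
    using inj_positions uv V V3 by (auto simp: inj_on_def)
  have vR: "p v \<in> ?R V3" "p v' \<in> ?R V3"
    using V3 unfolding drawn_def by auto
  have half: "connected (?R V3 \<union> (path_image (\<gamma> {v, u}) - {p u}))"
    using connected_drawn[OF V3(1)] connected_half_edge[OF V3(3)] uv pv pne vR
    by (intro connected_Un) auto
  then have K1: "connected K"
    unfolding K_def using connected_half_edge[OF V3(4)] uv pv pne vR
    by (intro connected_Un[OF half]) auto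
  have Keq: "K \<union> {p u, p h} = ?R V3 \<union> path_image (\<gamma> {v, u}) \<union> path_image (\<gamma> {v', h})"
    unfolding K_def using pv by auto
  have K2: "compact (K \<union> {p u, p h})"
    unfolding Keq using V3 by (intro compact_Un compact_drawn compact_arc_image edge_arc)
  have full: "connected (?R V3 \<union> path_image (\<gamma> {v, u}))"
    using connected_drawn[OF V3(1)] connected_edge[OF V3(3)] pv vR
    by (intro connected_Un) auto
  then have K3: "connected (K \<union> {p u, p h})"
    unfolding Keq using connected_edge[OF V3(4)] pv vR
    by (intro connected_Un[OF full]) auto
  have Kedge: "path_image (\<gamma> {w, t}) \<inter> (?R ?A \<union> ?R ?B) = {p t}"
    if "{w, t} \<in> edges G" "w \<in> V3" "t = u \<or> t = h" for w t
  proof -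
    have n: "w \<notin> ?A" "w \<notin> ?B" using that V by auto
    have "path_image (\<gamma> {w, t}) \<inter> ?R ?A = p ` ({w, t} \<inter> ?A)"
      using n AB that by (intro edge_Int_drawn) auto
    moreover have "path_image (\<gamma> {w, t}) \<inter> ?R ?B = p ` ({w, t} \<inter> ?B)"
      using n AB that by (intro edge_Int_drawn) auto
    moreover have "{w, t} \<inter> ?A = {t}" "{w, t} \<inter> ?B = {t}"
      using n that by auto
    ultimately show ?thesis
      by (simp only: Int_Un_distrib image_insert image_empty Un_absorb)
  qed
  have V3R: "?R V3 \<inter> (?R ?A \<union> ?R ?B) = {}"
  proof -
    have "V3 \<inter> ?A = {}" "V3 \<inter> ?B = {}" using V by auto
    then show ?thesis
      using drawn_disjoint[OF V(4) AB(1)] drawn_disjoint[OF V(4) AB(2)] by blast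
  qed
  have K4: "K \<inter> (?R ?A \<union> ?R ?B) = {}"
  proof -
    have "path_image (\<gamma> {v, u}) \<inter> (?R ?A \<union> ?R ?B) = {p u}"
      "path_image (\<gamma> {v', h}) \<inter> (?R ?A \<union> ?R ?B) = {p h}"
      using Kedge V3 by simp_all
    moreover have "(R \<union> (E - {x}) \<union> (E' - {y})) \<inter> D = {}"
      if "E \<inter> D = {x}" "E' \<inter> D = {y}" "R \<inter> D = {}" for R E E' D :: "complex set" and x y
      using that by blast
    ultimately show ?thesis using V3R unfolding K_def by blast
  qed
  have Zdisj: "?R Z \<inter> ?R X = {}" if "Z \<inter> X = {}" "Z \<subseteq> verts G" "X \<subseteq> verts G" for Z X
    using that drawn_disjoint by blast
  have KX: "K \<union> {p u, p h} \<subseteq> ?R (V3 \<union> {u, h})"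
    unfolding Keq using V3 unfolding drawn_def by auto
  obtain z where z: "z \<in> V4" using V4 by blast
  have inR: "p x \<in> ?R X" if "x \<in> X" for x X
    using that unfolding drawn_def by blast
  have hub: "?R (insert b V4) \<inter> (path_image c \<union> (K \<union> {p u, p h})) = {}"
    if "path_image c \<subseteq> ?R X" "X = ?A \<or> X = ?B" "b \<notin> X" "b \<in> set xs \<union> set ys" for b c X
  proof -
    have 1: "insert b V4 \<subseteq> verts G" "X \<subseteq> verts G" "V3 \<union> {u, h} \<subseteq> verts G"
      using that V by auto
    have 2: "insert b V4 \<inter> X = {}" "insert b V4 \<inter> (V3 \<union> {u, h}) = {}"
      using that V c1 c2 by auto
    show ?thesis
      using Zdisj[OF 2(1) 1(1,2)] Zdisj[OF 2(2) 1(1,3)] that(1) KX by blast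
  qed
  show False
  proof (rule theta_curve_separation[OF C1(1-3) C2(1-3) _ K1 K2 K3])
    show "path_image c1 \<inter> path_image c2 = {p u, p h}"
      using C1 C2 RAB pu by blast
    show "K \<inter> (path_image c1 \<union> path_image c2) = {}"
      using K4 C1 C2 by blast
    show "connected (?R (insert b1 V4))" "connected (?R (insert b2 V4))" "connected (?R (V3 \<union> V4))"
      using V4 connected_drawn by blast+
    show "p z \<in> ?R (insert b1 V4)" "p z \<in> ?R (insert b2 V4)" "p z \<in> ?R (V3 \<union> V4)"
      using z by (auto intro: inR)
    show "p b1 \<in> ?R (insert b1 V4)" "p b2 \<in> ?R (insert b2 V4)" "p v \<in> ?R (V3 \<union> V4)"
      using V3 by (auto intro: inR)
    show "p b1 \<in> path_image c1" "p b2 \<in> path_image c2"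
      using C1 C2 c12 by auto
    show "p v \<in> K"
      unfolding K_def using vR by blast
    show "?R (insert b1 V4) \<inter> (path_image c2 \<union> (K \<union> {p u, p h})) = {}"
      using c1 c12 by (intro hub[OF C2(5)]) auto
    show "?R (insert b2 V4) \<inter> (path_image c1 \<union> (K \<union> {p u, p h})) = {}"
      using c2 c12 by (intro hub[OF C1(5)]) auto
    have "(V3 \<union> V4) \<inter> ?A = {}" "(V3 \<union> V4) \<inter> ?B = {}" "V3 \<union> V4 \<subseteq> verts G"
      using V by auto
    then have "?R (V3 \<union> V4) \<inter> ?R ?A = {}" "?R (V3 \<union> V4) \<inter> ?R ?B = {}"
      using Zdisj AB(1,2) by simp_all
    then show "?R (V3 \<union> V4) \<inter> (path_image c1 \<union> path_image c2) = {}"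
      using C1(5) C2(5) by (simp only: Int_Un_distrib) (metis Int_mono Un_empty subset_empty order_refl)
  qed
qed

end

section \<open>Joining two components by an edge\<close>

text \<open>
  The part drawn on \<open>B\<close> is inverted about \<open>d\<close> into a small disc around \<open>c\<close>; the inversion is
  normalised so that the segment from \<open>d\<close> to \<open>p b\<close> turns into a subset of the ray from \<open>c\<close> towards \<open>p a\<close>.
\<close>

lemma planar_join_components:
  assumes drw: "plane_drawing G p \<gamma>" and sg: "simple_graph G" and fin: "finite (verts G)"
    and AB: "verts G = A \<union> B" "A \<inter> B = {}" "\<And>e. e \<in> edges G \<Longrightarrow> e \<subseteq> A \<or> e \<subseteq> B"
    and a: "a \<in> A" "c \<noteq> p a" "closed_segment c (p a) \<inter> drawn G p \<gamma> A = {p a}"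
    and b: "b \<in> B" "d \<noteq> p b" "closed_segment d (p b) \<inter> drawn G p \<gamma> B = {p b}"
  shows "planar \<lparr>verts = verts G, edges = insert {a, b} (edges G)\<rparr>"
proof -
  let ?DA = "drawn G p \<gamma> A" and ?DB = "drawn G p \<gamma> B"
  have sub: "A \<subseteq> verts G" "B \<subseteq> verts G" using AB by auto
  have "finite A" "finite B" using fin sub by (auto intro: finite_subset)
  then have cpt: "compact ?DA" "compact ?DB"
    using compact_drawn[OF drw sg] by auto
  have "c \<notin> ?DA" "d \<notin> ?DB" using a b by auto
  then obtain r s where r: "r > 0" "ball c r \<subseteq> - ?DA" and s: "s > 0" "ball d s \<subseteq> - ?DB"
    using cpt by (meson ComplI compact_imp_closed open_Compl open_contains_ball)
  \<comment> \<open>This numerator yields \<open>\<phi> (p b) = c + \<rho> * (p a - c)\<close>, a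
    point of the segment from \<open>c\<close> to \<open>p a\<close>.\<close>
  define \<kappa>0 where "\<kappa>0 = (p a - c) * (p b - d)"
  have \<kappa>0: "\<kappa>0 \<noteq> 0" using a b by (simp add: \<kappa>0_def)
  \<comment> \<open>Points of \<open>?DB\<close> are at distance at least \<open>s\<close> from
    \<open>d\<close>, so \<open>\<rho> * norm \<kappa>0 < r * s\<close> sends them into the ball of
    radius \<open>r\<close> about \<open>c\<close>, which misses \<open>?DA\<close>;
    \<open>\<rho> < 1\<close> places the image of \<open>p b\<close> strictly before
    \<open>p a\<close>.\<close>
  define \<rho> where "\<rho> = min (1/2) (r * s / (2 * norm \<kappa>0))"
  have \<rho>: "0 < \<rho>" "\<rho> < 1" "\<rho> * norm \<kappa>0 < r * s"
  proof -
    show "0 < \<rho>" using r s \<kappa>0 by (simp add: \<rho>_def)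
    show "\<rho> < 1" using min.cobounded1[of "1/2"] by (simp add: \<rho>_def min_less_iff_disj)
    have "\<rho> * norm \<kappa>0 \<le> r * s / (2 * norm \<kappa>0) * norm \<kappa>0"
      by (intro mult_right_mono) (auto simp: \<rho>_def)
    also have "\<dots> = r * s / 2" using \<kappa>0 by simp
    also have "\<dots> < r * s" using r s by simp
    finally show "\<rho> * norm \<kappa>0 < r * s" .
  qed
  define \<phi> where "\<phi> z = c + of_real \<rho> * \<kappa>0 / (z - d)" for z
  have inj: "inj_on \<phi> (- {d})"
    using \<rho> \<kappa>0 by (auto simp: inj_on_def \<phi>_def field_simps)
  have cont: "continuous_on (- {d}) \<phi>"
    unfolding \<phi>_def by (intro continuous_intros) auto
  have DBd: "?DB \<subseteq> - {d}" using \<open>d \<notin> ?DB\<close> by blast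
  have injB: "inj_on \<phi> ?DB" by (rule inj_on_subset[OF inj DBd])
  have near: "\<phi> z \<in> ball c r" if "z \<in> ?DB" for z
  proof -
    have "norm (z - d) \<ge> s"
      using that s(2) by (force simp: dist_norm norm_minus_commute)
    then have "norm (of_real \<rho> * \<kappa>0 / (z - d)) \<le> \<rho> * norm \<kappa>0 / s"
      using \<rho> s by (simp add: norm_mult norm_divide frac_le)
    also have "\<dots> < r" using \<rho>(3) s by (simp add: field_simps)
    finally show ?thesis by (simp add: \<phi>_def dist_norm norm_divide norm_mult)
  qed
  then have disj: "?DA \<inter> \<phi> ` ?DB = {}" using r by blast
  define L where "L = linepath (p a) (\<phi> (p b))"
  have \<phi>b: "\<phi> (p b) = c + of_real \<rho> * (p a - c)"
    using b by (simp add: \<phi>_def \<kappa>0_def)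
  have pb: "p b \<in> ?DB" and pa: "p a \<in> ?DA" using a b by (auto simp: drawn_def)
  have pL: "\<exists>t. \<rho> \<le> t \<and> t \<le> 1 \<and> z = c + of_real t * (p a - c)" if z: "z \<in> path_image L" for z
  proof -
    obtain u where u: "0 \<le> u" "u \<le> 1" "z = (1 - u) *\<^sub>R p a + u *\<^sub>R \<phi> (p b)"
      using z by (auto simp: L_def closed_segment_def)
    have "(1 - u) + u * \<rho> \<le> 1" using u \<rho> by (simp add: mult_left_le)
    moreover have "\<rho> \<le> (1 - u) + u * \<rho>"
    proof -
      have "0 \<le> (1 - u) * (1 - \<rho>)" using u \<rho> by simp
      then show ?thesis by (simp add: algebra_simps)
    qed
    moreover have "z = c + of_real ((1 - u) + u * \<rho>) * (p a - c)"
      by (simp add: u(3) \<phi>b scaleR_conv_of_real algebra_simps)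
    ultimately show ?thesis by blast
  qed
  have LA: "path_image L \<inter> ?DA = {p a}"
  proof -
    have "path_image L \<subseteq> closed_segment c (p a)"
    proof
      fix z assume "z \<in> path_image L"
      then obtain t where "\<rho> \<le> t" "t \<le> 1" "z = c + of_real t * (p a - c)"
        using pL by blast
      then show "z \<in> closed_segment c (p a)"
        using \<rho> by (auto simp: closed_segment_def scaleR_conv_of_real algebra_simps intro!: exI[of _ t])
    qed
    moreover have "p a \<in> path_image L" by (simp add: L_def)
    ultimately show ?thesis using a(3) pa by blast
  qed
  have LB: "path_image L \<inter> \<phi> ` ?DB = {\<phi> (p b)}"
  proof -
    \<comment> \<open>If \<open>\<phi> z\<close> has parameter \<open>t\<close> on the ray, then
      \<open>z = d + (\<rho> / t) * (p b - d)\<close>. As \<open>\<rho> \<le> t\<close>, this lies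
      on the segment from \<open>d\<close> to \<open>p b\<close>, which meets \<open>?DB\<close>
      only in \<open>p b\<close>.\<close>
    have "z = p b" if z: "z \<in> ?DB" "\<phi> z \<in> path_image L" for z
    proof -
      obtain t where t: "\<rho> \<le> t" "t \<le> 1" "\<phi> z = c + of_real t * (p a - c)"
        using pL z by blast
      have zd: "z - d \<noteq> 0" using z DBd by auto
      have t0: "t \<noteq> 0" using t \<rho> by auto
      have "of_real \<rho> * ((p a - c) * (p b - d)) = of_real t * (p a - c) * (z - d)"
        using t(3) zd by (simp add: \<phi>_def \<kappa>0_def field_simps)
      then have "(p a - c) * (of_real \<rho> * (p b - d)) = (p a - c) * (of_real t * (z - d))"
        by (simp only: mult_ac)
      then have "of_real \<rho> * (p b - d) = of_real t * (z - d)"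
        using a(2) by simp
      then have "z - d = of_real (\<rho> / t) * (p b - d)"
        using t0 by (simp add: field_simps)
      then have "z = (1 - \<rho> / t) *\<^sub>R d + (\<rho> / t) *\<^sub>R p b"
        unfolding scaleR_conv_of_real diff_eq_eq
        by (simp add: algebra_simps del: of_real_divide)
      moreover have "0 \<le> \<rho> / t" "\<rho> / t \<le> 1" using t \<rho> by auto
      ultimately have "z \<in> closed_segment d (p b)"
        unfolding closed_segment_def by blast
      then show ?thesis using b(3) z by blast
    qed
    moreover have "\<phi> (p b) \<in> path_image L" by (simp add: L_def)
    ultimately show ?thesis using pb by blast
  qed
  define p' where "p' v = (if v \<in> A then p v else \<phi> (p v))" for v
  define \<gamma>' where "\<gamma>' e = (if e = {a, b} then L else if e \<subseteq> A then \<gamma> e else \<phi> \<circ> \<gamma> e)" for e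
  have p'A: "p' ` X = p ` X" if "X \<subseteq> A" for X
    using that by (auto simp: p'_def intro!: image_cong)
  have p'B: "p' ` X = \<phi> ` p ` X" if "X \<subseteq> B" for X
  proof -
    have "\<And>x. x \<in> X \<Longrightarrow> p' x = \<phi> (p x)" using that AB by (auto simp: p'_def)
    then show ?thesis by (simp add: image_image)
  qed
  have p'ab: "p' a = p a" "p' b = \<phi> (p b)"
    using a b AB by (auto simp: p'_def)
  have pA: "p ` A \<subseteq> ?DA" "p ` B \<subseteq> ?DB" by (auto simp: drawn_def)
  have new: "{a, b} \<notin> edges G" using AB a b by blast
  have ne: "e \<noteq> {}" if "e \<in> edges G" for e
    using that sg by (auto simp: simple_graph_def)
  have eA: "\<gamma>' e = \<gamma> e" "path_image (\<gamma> e) \<subseteq> ?DA" if "e \<in> edges G" "e \<subseteq> A" for e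
    using that new by (auto simp: \<gamma>'_def drawn_def)
  have eB: "\<gamma>' e = \<phi> \<circ> \<gamma> e" "path_image (\<gamma>' e) = \<phi> ` path_image (\<gamma> e)" "path_image (\<gamma> e) \<subseteq> ?DB"
    if "e \<in> edges G" "e \<subseteq> B" for e
  proof -
    have "\<not> e \<subseteq> A" using that ne AB by blast
    then show "\<gamma>' e = \<phi> \<circ> \<gamma> e" "path_image (\<gamma>' e) = \<phi> ` path_image (\<gamma> e)"
      using that new by (auto simp: \<gamma>'_def path_image_compose)
    show "path_image (\<gamma> e) \<subseteq> ?DB" using that by (auto simp: drawn_def)
  qed
  note ev = edge_Int_verts[OF drw]
  have inj': "inj_on p' (A \<union> B)"
  proof -
    have injp: "inj_on p (verts G)" using inj_positions[OF drw sg] .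
    have "inj_on p' A"
      using inj_on_subset[OF injp sub(1)] by (auto simp: inj_on_def p'_def)
    moreover have "inj_on p' B"
    proof -
      have "inj_on (\<phi> \<circ> p) B"
        using inj_on_subset[OF injp sub(2)] inj_on_subset[OF injB pA(2)] by (rule comp_inj_on)
      moreover have "\<And>x. x \<in> B \<Longrightarrow> p' x = (\<phi> \<circ> p) x" using AB by (auto simp: p'_def)
      ultimately show ?thesis using inj_on_cong by blast
    qed
    moreover have "p' ` A \<inter> p' ` B = {}"
      using p'A[of A] p'B[of B] disj pA by blast
    ultimately show ?thesis by (auto simp: inj_on_Un)
  qed
  have p'V: "p' ` (A \<union> B) = p ` A \<union> \<phi> ` p ` B"
    using p'A[of A] p'B[of B] by (simp add: image_Un)
  have edgeA: "path_image (\<gamma>' e) \<inter> p' ` (A \<union> B) = p' ` e" if e: "e \<in> edges G" "e \<subseteq> A" for e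
  proof -
    have "path_image (\<gamma> e) \<inter> \<phi> ` p ` B = {}" using eA[OF e] disj pA by blast
    moreover have "path_image (\<gamma> e) \<inter> p ` A = p ` e"
      using ev[OF sg e(1)] e(2) AB(1) by blast
    ultimately show ?thesis using p'V p'A[OF e(2)] eA[OF e] by (simp add: Int_Un_distrib)
  qed
  have edgeB: "path_image (\<gamma>' e) \<inter> p' ` (A \<union> B) = p' ` e" if e: "e \<in> edges G" "e \<subseteq> B" for e
  proof -
    have "\<phi> ` path_image (\<gamma> e) \<inter> p ` A = {}" using eB[OF e] disj pA by blast
    moreover have "\<phi> ` path_image (\<gamma> e) \<inter> \<phi> ` p ` B = \<phi> ` p ` e"
    proof -
      have "path_image (\<gamma> e) \<inter> p ` B = p ` e" using ev[OF sg e(1)] e(2) AB(1) by blast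
      then show ?thesis using inj_on_image_Int[OF injB eB(3)[OF e] pA(2)] by simp
    qed
    ultimately show ?thesis using p'V p'B[OF e(2)] eB[OF e] by (simp add: Int_Un_distrib)
  qed
  have edgeL: "path_image L \<inter> p' ` (A \<union> B) = p' ` {a, b}"
  proof -
    have "path_image L \<inter> p ` A = {p a}" "path_image L \<inter> \<phi> ` p ` B = {\<phi> (p b)}"
      using LA LB pA a(1) b(1) by blast+
    then show ?thesis using p'V p'ab by (simp add: Int_Un_distrib insert_commute)
  qed
  have Ledge: "path_image (\<gamma>' e) \<inter> path_image L = p' ` (e \<inter> {a, b})" if e: "e \<in> edges G" for e
  proof -
    consider "e \<subseteq> A" | "e \<subseteq> B" using AB(3)[OF e] by blast
    then have "path_image (\<gamma>' e) \<inter> path_image L \<subseteq> p' ` (A \<union> B)"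
    proof cases
      case 1
      then have "path_image (\<gamma>' e) \<inter> path_image L \<subseteq> {p' a}"
        using eA[OF e 1] LA p'ab by fastforce
      then show ?thesis using a(1) by blast
    next
      case 2
      then have "path_image (\<gamma>' e) \<subseteq> \<phi> ` ?DB"
        using eB(2,3)[OF e 2] by (simp only: image_mono)
      then have "path_image (\<gamma>' e) \<inter> path_image L \<subseteq> {p' b}"
        using LB p'ab by fastforce
      then show ?thesis using b(1) by blast
    qed
    moreover have "path_image (\<gamma>' e) \<inter> p' ` (A \<union> B) = p' ` e"
      using edgeA edgeB AB(3)[OF e] e by blast
    ultimately have "path_image (\<gamma>' e) \<inter> path_image L = p' ` e \<inter> p' ` {a, b}"
      using edgeL by blast
    moreover have "e \<subseteq> A \<union> B" "{a, b} \<subseteq> A \<union> B"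
      using AB(3)[OF e] a(1) b(1) by auto
    ultimately show ?thesis
      using inj_on_image_Int[OF inj'] by simp
  qed
  have ee: "path_image (\<gamma>' e) \<inter> path_image (\<gamma>' f) = p' ` (e \<inter> f)"
    if e: "e \<in> edges G" "f \<in> edges G" "e \<noteq> f" for e f
  proof -
    note ef = edge_Int_edge[OF drw sg e]
    consider "e \<subseteq> A" "f \<subseteq> A" | "e \<subseteq> B" "f \<subseteq> B" | "e \<subseteq> A" "f \<subseteq> B" | "e \<subseteq> B" "f \<subseteq> A"
      using AB(3) e by blast
    then show ?thesis
    proof cases
      case 1
      moreover have "e \<inter> f \<subseteq> A" using 1 by blast
      ultimately show ?thesis using ef eA e p'A by simp
    next
      case 2
      moreover have "e \<inter> f \<subseteq> B" using 2 by blast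
      ultimately show ?thesis
        using ef eB(2)[OF e(1) 2(1)] eB(2)[OF e(2) 2(2)] p'B
          inj_on_image_Int[OF injB eB(3)[OF e(1) 2(1)] eB(3)[OF e(2) 2(2)]] by simp
    next
      case 3
      then have "e \<inter> f = {}" using AB by blast
      moreover have "path_image (\<gamma>' e) \<subseteq> ?DA" "path_image (\<gamma>' f) \<subseteq> \<phi> ` ?DB"
        using eA[OF e(1)] eB[OF e(2)] 3 by auto
      ultimately show ?thesis using disj by auto
    next
      case 4
      then have "e \<inter> f = {}" using AB by blast
      moreover have "path_image (\<gamma>' f) \<subseteq> ?DA" "path_image (\<gamma>' e) \<subseteq> \<phi> ` ?DB"
        using eA[OF e(2)] eB[OF e(1)] 4 by auto
      ultimately show ?thesis using disj by auto
    qed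
  qed
  have arcs: "arc (\<gamma>' e) \<and> {pathstart (\<gamma>' e), pathfinish (\<gamma>' e)} = p' ` e" if e: "e \<in> edges G" for e
  proof -
    note end' = edge_ends[OF drw sg e] and arc' = edge_arc[OF drw sg e]
    consider "e \<subseteq> A" | "e \<subseteq> B" using AB(3)[OF e] by blast
    then show ?thesis
    proof cases
      case 1
      then show ?thesis using end' arc' eA[OF e 1] p'A[OF 1] by simp
    next
      case 2
      have s: "path_image (\<gamma> e) \<subseteq> - {d}" using eB(3)[OF e 2] DBd by blast
      have "arc (\<phi> \<circ> \<gamma> e)"
        unfolding arc_def
      proof
        show "path (\<phi> \<circ> \<gamma> e)"
          using arc' by (intro path_continuous_image continuous_on_subset[OF cont s] arc_imp_path)
        show "inj_on (\<phi> \<circ> \<gamma> e) {0..1}"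
          using arc_imp_inj_on[OF arc'] inj_on_subset[OF inj s] unfolding path_image_def
          by (rule comp_inj_on)
      qed
      moreover have "{\<phi> (pathstart (\<gamma> e)), \<phi> (pathfinish (\<gamma> e))} = \<phi> ` p ` e"
        using end' by (metis image_empty image_insert)
      ultimately show ?thesis
        using eB[OF e 2] p'B[OF 2] by (simp add: pathstart_compose pathfinish_compose)
    qed
  qed
  have "p a \<noteq> \<phi> (p b)" using disj pa pb by blast
  then have Larc: "arc L \<and> {pathstart L, pathfinish L} = p' ` {a, b}"
    using p'ab by (simp add: L_def)
  have \<gamma>L: "\<gamma>' {a, b} = L" by (simp add: \<gamma>'_def)
  have "plane_drawing \<lparr>verts = verts G, edges = insert {a, b} (edges G)\<rparr> p' \<gamma>'"
    unfolding plane_drawing_def graph.simps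
  proof (intro conjI)
    show "inj_on p' (verts G)" using inj' AB by simp
    show "\<forall>e\<in>insert {a, b} (edges G). arc (\<gamma>' e) \<and> {pathstart (\<gamma>' e), pathfinish (\<gamma>' e)} = p' ` e"
      using arcs Larc \<gamma>L by auto
    show "\<forall>e\<in>insert {a, b} (edges G). path_image (\<gamma>' e) \<inter> p' ` verts G = p' ` e"
      using edgeA edgeB edgeL \<gamma>L AB(1,3) by (metis insertE)
    show "\<forall>e\<in>insert {a, b} (edges G). \<forall>f\<in>insert {a, b} (edges G).
        e \<noteq> f \<longrightarrow> path_image (\<gamma>' e) \<inter> path_image (\<gamma>' f) = p' ` (e \<inter> f)"
      using ee Ledge \<gamma>L by (metis Int_commute insertE)
  qed
  then show ?thesis unfolding planar_def by blast
qed

section \<open>The lattice drawing\<close>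

definition core :: "int \<Rightarrow> int"
  where "core v = v div (2 ^ multiplicity 2 v * 3 ^ multiplicity 3 v * 5 ^ multiplicity 5 v)"

lemma core_decomposition:
  assumes "v \<noteq> 0"
  shows "v = core v * 2 ^ multiplicity 2 v * 3 ^ multiplicity 3 v * 5 ^ multiplicity 5 v"
proof -
  let ?a = "multiplicity 2 v" and ?b = "multiplicity 3 v" and ?c = "multiplicity 5 v"
  have "coprime ((2::int) ^ ?a) (3 ^ ?b)"
    by (intro coprime_power_left_iff[THEN iffD2] coprime_power_right_iff[THEN iffD2] disjI1)
      (rule primes_coprime; simp)
  then have "2 ^ ?a * 3 ^ ?b dvd v"
    by (intro divides_mult multiplicity_dvd)
  moreover have "coprime ((2::int) ^ ?a * 3 ^ ?b) (5 ^ ?c)"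
    by (intro coprime_mult_left_iff[THEN iffD2] conjI coprime_power_left_iff[THEN iffD2]
        coprime_power_right_iff[THEN iffD2] disjI1)
      (rule primes_coprime; simp)+
  ultimately have "2 ^ ?a * 3 ^ ?b * 5 ^ ?c dvd v"
    by (rule divides_mult[OF _ multiplicity_dvd])
  then have "v div (2 ^ ?a * 3 ^ ?b * 5 ^ ?c) * (2 ^ ?a * 3 ^ ?b * 5 ^ ?c) = v"
    by (rule dvd_div_mult_self)
  then show ?thesis unfolding core_def mult.assoc by (rule sym)
qed

lemma multiplicity_times_int:
  fixes v :: int
  assumes "v \<noteq> 0"
  shows "multiplicity 2 (2 * v) = Suc (multiplicity 2 v)" "multiplicity 3 (2 * v) = multiplicity 3 v"
    "multiplicity 5 (2 * v) = multiplicity 5 v"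
    "multiplicity 2 (3 * v) = multiplicity 2 v" "multiplicity 3 (3 * v) = Suc (multiplicity 3 v)"
    "multiplicity 5 (3 * v) = multiplicity 5 v"
    "multiplicity 2 (5 * v) = multiplicity 2 v" "multiplicity 3 (5 * v) = multiplicity 3 v"
    "multiplicity 5 (5 * v) = Suc (multiplicity 5 v)"
    "multiplicity 2 (7 * v) = multiplicity 2 v" "multiplicity 3 (7 * v) = multiplicity 3 v"
    "multiplicity 5 (7 * v) = multiplicity 5 v"
proof -
  have p: "prime_elem (2::int)" "prime_elem (3::int)" "prime_elem (5::int)"
    by (rule prime_imp_prime_elem; simp)+
  have o: "multiplicity 2 (3::int) = 0" "multiplicity 2 (5::int) = 0" "multiplicity 2 (7::int) = 0"
    "multiplicity 3 (2::int) = 0" "multiplicity 3 (5::int) = 0" "multiplicity 3 (7::int) = 0"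
    "multiplicity 5 (2::int) = 0" "multiplicity 5 (3::int) = 0" "multiplicity 5 (7::int) = 0"
    by (simp_all add: not_dvd_imp_multiplicity_0)
  show "multiplicity 2 (2 * v) = Suc (multiplicity 2 v)" "multiplicity 3 (2 * v) = multiplicity 3 v"
    "multiplicity 5 (2 * v) = multiplicity 5 v"
    "multiplicity 2 (3 * v) = multiplicity 2 v" "multiplicity 3 (3 * v) = Suc (multiplicity 3 v)"
    "multiplicity 5 (3 * v) = multiplicity 5 v"
    "multiplicity 2 (5 * v) = multiplicity 2 v" "multiplicity 3 (5 * v) = multiplicity 3 v"
    "multiplicity 5 (5 * v) = Suc (multiplicity 5 v)"
    "multiplicity 2 (7 * v) = multiplicity 2 v" "multiplicity 3 (7 * v) = multiplicity 3 v"
    "multiplicity 5 (7 * v) = multiplicity 5 v"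
    using assms p by (simp_all add: prime_elem_multiplicity_mult_distrib o)
qed

lemma core_times:
  assumes "v \<noteq> 0"
  shows "core (2 * v) = core v" "core (3 * v) = core v" "core (5 * v) = core v"
    "core (7 * v) = 7 * core v"
proof -
  define P :: int where "P = 2 ^ multiplicity 2 v * 3 ^ multiplicity 3 v * 5 ^ multiplicity 5 v"
  have v: "v = core v * P" using core_decomposition[OF assms] by (simp add: P_def mult.assoc)
  have P: "P \<noteq> 0" using v assms by auto
  have "core (2 * v) = 2 * v div (2 * P)" "core (3 * v) = 3 * v div (3 * P)"
    "core (5 * v) = 5 * v div (5 * P)" "core (7 * v) = 7 * v div P"
    using assms by (simp_all add: core_def P_def multiplicity_times_int mult.assoc mult.left_commute)
  moreover have "core v = v div P" by (simp add: core_def P_def)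
  moreover have "7 * v div P = 7 * core v"
    using P by (subst v) (simp add: mult.assoc[symmetric])
  ultimately show "core (2 * v) = core v" "core (3 * v) = core v" "core (5 * v) = core v"
    "core (7 * v) = 7 * core v"
    by simp_all
qed

text \<open>Bounds the exponents, so that the spacing \<open>2 * m + 1\<close> of the sheets exceeds
  every difference of the exponent parts of \<open>xpos\<close>.\<close>

lemma multiplicity_less_self:
  fixes v :: int
  assumes "v > 0" "q \<ge> 2"
  shows "int (multiplicity q v) < v"
proof -
  have "int (multiplicity q v) < 2 ^ multiplicity q v"
    using less_exp[of "multiplicity q v"] by (metis of_nat_less_iff of_nat_numeral of_nat_power)
  also have "\<dots> \<le> q ^ multiplicity q v"
    using assms by (intro power_mono) auto
  also have "\<dots> \<le> v"
    using assms multiplicity_dvd by (intro zdvd_imp_le) auto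
  finally show ?thesis .
qed

text \<open>The factor \<open>2 * m + 1\<close> keeps the sheets of different \<open>core v\<close> apart for \<open>v \<le> m\<close>.\<close>

definition xpos :: "int \<Rightarrow> int \<Rightarrow> int"
  where "xpos m v = int (multiplicity 2 v) - int (multiplicity 5 v) + (2 * m + 1) * core v"

definition ypos :: "int \<Rightarrow> int"
  where "ypos v = int (multiplicity 3 v) - int (multiplicity 5 v)"

text \<open>The exponent parts of \<open>xpos\<close> differ by less than the spacing, so equal
  positions force equal \<open>core\<close>. Then all three exponents differ by the same
  \<open>d\<close>, the quotient is \<open>30 ^ d\<close>, and a ratio of at most 7 allows only
  \<open>d = 0\<close>.\<close>

lemma pos_inj:
  assumes n: "0 < n" and uv: "u \<in> {n..m}" "v \<in> {n..m}" "m \<le> 7 * n"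
    and eq: "xpos m u = xpos m v" "ypos u = ypos v"
  shows "u = v"
proof -
  \<comment> \<open>The situation is symmetric in \<open>u\<close> and \<open>v\<close>; ordering
    the exponents of 5 makes the common shift \<open>d\<close> a natural number.\<close>
  have main: "u = v" if uv: "u \<in> {n..m}" "v \<in> {n..m}" and eq: "xpos m u = xpos m v" "ypos u = ypos v"
      and le: "multiplicity 5 v \<le> multiplicity 5 u" for u v
  proof -
    have u0: "u > 0" "u \<le> m" and v0: "v > 0" "v \<le> m" using uv n by auto
    let ?d = "(int (multiplicity 2 v) - int (multiplicity 5 v)) -
      (int (multiplicity 2 u) - int (multiplicity 5 u))"
    have "\<bar>?d\<bar> < 2 * m + 1"
      using multiplicity_less_self[OF u0(1), of 2] multiplicity_less_self[OF u0(1), of 5]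
        multiplicity_less_self[OF v0(1), of 2] multiplicity_less_self[OF v0(1), of 5] u0 v0 by simp
    moreover have dd: "?d = (2 * m + 1) * (core u - core v)"
      using eq(1) by (simp add: xpos_def algebra_simps)
    ultimately have "\<bar>2 * m + 1\<bar> * \<bar>core u - core v\<bar> < \<bar>2 * m + 1\<bar> * 1"
      using u0 by (simp add: abs_mult)
    then have "\<bar>core u - core v\<bar> < 1"
      by (rule mult_left_less_imp_less) simp
    then have c: "core u = core v" by simp
    define d where "d = multiplicity 5 u - multiplicity 5 v"
    have "multiplicity 5 u = multiplicity 5 v + d" using le by (simp add: d_def)
    moreover have "multiplicity 2 u = multiplicity 2 v + d"
      using dd c le by (simp add: d_def)
    moreover have "multiplicity 3 u = multiplicity 3 v + d"
      using eq(2) le by (simp add: d_def ypos_def)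
    ultimately have "u = v * (2 ^ d * 3 ^ d * 5 ^ d)"
      using core_decomposition[of u] core_decomposition[of v] u0 v0 c
      by (simp add: power_add mult_ac)
    also have "(2 ^ d * 3 ^ d * 5 ^ d :: int) = 30 ^ d"
      by (simp flip: power_mult_distrib)
    finally have u: "u = v * 30 ^ d" .
    have "d = 0"
    proof (rule ccontr)
      assume "d \<noteq> 0"
      then have "(30::int) ^ 1 \<le> 30 ^ d" by (intro power_increasing) auto
      then have "v * 30 \<le> u" using u v0 by simp
      then show False using uv assms(4) n by simp
    qed
    then show ?thesis using u by simp
  qed
  show ?thesis
    using main[of u v] main[of v u] uv eq by (metis nat_le_linear)
qed

lemma pos_times:
  assumes "v \<noteq> 0"
  shows "xpos m (2 * v) = xpos m v + 1" "xpos m (3 * v) = xpos m v" "xpos m (5 * v) = xpos m v - 1"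
    "ypos (2 * v) = ypos v" "ypos (3 * v) = ypos v + 1" "ypos (5 * v) = ypos v - 1"
  using assms by (simp_all add: xpos_def ypos_def multiplicity_times_int core_times)

text \<open>Quotient 7 is left out: its only instance is added later, across two components of this
  graph.\<close>

definition lattice_edges :: "int \<Rightarrow> int \<Rightarrow> int set set"
  where "lattice_edges n m = {{u, k * u} | u k. n \<le> u \<and> 2 \<le> k \<and> k \<le> 6 \<and> k * u \<le> m}"

section \<open>Shapes of the edges and exclusion of crossings\<close>

context
  fixes n m :: int
  assumes n: "0 < n" and nm: "m \<le> 7 * n"
begin

definition vertex_pt :: "int \<Rightarrow> complex"
  where "vertex_pt v = Complex (xpos m v) (ypos v)"

definition bend_side :: "int \<Rightarrow> real"
  where "bend_side u = (if 3 * n \<le> 2 * u then 1 else - 1)"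

text \<open>With height 1/4, less than 1/2, the fractional part of the imaginary part reveals the
  side, and the slope 1/4 differs from the slope 1 of the edges with quotients 5 and 6.\<close>

definition bend :: "int \<Rightarrow> complex"
  where "bend u = Complex (real_of_int (xpos m u) + 1) (ypos u + bend_side u / 4)"

definition edge_path :: "int set \<Rightarrow> real \<Rightarrow> complex"
  where "edge_path e = (let u = Min e; v = Max e in
    if v = 4 * u then linepath (vertex_pt u) (bend u) +++ linepath (bend u) (vertex_pt v) else linepath (vertex_pt u) (vertex_pt v))"

text \<open>The open edge written in coordinates, so that floors and fractional parts of a point
  identify the edges through it.\<close>

definition edge_interior :: "int \<Rightarrow> int \<Rightarrow> complex \<Rightarrow> bool"
  where "edge_interior u k z \<longleftrightarrow>
    (k = 2 \<and> (\<exists>s :: real. 0 < s \<and> s < 1 \<and> Re z = xpos m u + s \<and> Im z = ypos u)) \<or>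
    (k = 3 \<and> (\<exists>s :: real. 0 < s \<and> s < 1 \<and> Re z = xpos m u \<and> Im z = ypos u + s)) \<or>
    (k = 4 \<and> (\<exists>s :: real. 0 < s \<and> s < 2 \<and> Re z = xpos m u + s \<and> Im z = ypos u + bend_side u * (1 - \<bar>s - 1\<bar>) / 4)) \<or>
    (k = 5 \<and> (\<exists>s :: real. 0 < s \<and> s < 1 \<and> Re z = xpos m u - s \<and> Im z = ypos u - s)) \<or>
    (k = 6 \<and> (\<exists>s :: real. 0 < s \<and> s < 1 \<and> Re z = xpos m u + s \<and> Im z = ypos u + s))"

lemma pt_inj: "u \<in> {n..m} \<Longrightarrow> v \<in> {n..m} \<Longrightarrow> xpos m u = xpos m v \<Longrightarrow> ypos u = ypos v \<Longrightarrow> u = v"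
  using pos_inj[OF n] nm by blast

lemma inj_on_pt: "inj_on vertex_pt {n..m}"
  using pt_inj by (auto simp: inj_on_def vertex_pt_def)

lemma pos_steps:
  assumes "u \<noteq> 0"
  shows "xpos m (2 * u) = xpos m u + 1" "ypos (2 * u) = ypos u" "xpos m (3 * u) = xpos m u" "ypos (3 * u) = ypos u + 1"
    "xpos m (4 * u) = xpos m u + 2" "ypos (4 * u) = ypos u" "xpos m (5 * u) = xpos m u - 1" "ypos (5 * u) = ypos u - 1"
    "xpos m (6 * u) = xpos m u + 1" "ypos (6 * u) = ypos u + 1"
  using assms pos_times[of u] pos_times[of "2 * u"] by auto

lemma bend_side_cases: "bend_side u = 1 \<or> bend_side u = - 1"
  by (simp add: bend_side_def)

lemma linepath_split:
  assumes "z \<in> closed_segment (Complex a b) (Complex a' b')"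
  shows "z = Complex a b \<or> z = Complex a' b' \<or>
    (\<exists>s :: real. 0 < s \<and> s < 1 \<and> Re z = a + s * (a' - a) \<and> Im z = b + s * (b' - b))"
proof -
  obtain s where s: "0 \<le> s" "s \<le> 1" "z = (1 - s) *\<^sub>R Complex a b + s *\<^sub>R Complex a' b'"
    using assms by (auto simp: closed_segment_def)
  have "Re z = a + s * (a' - a)" "Im z = b + s * (b' - b)"
    unfolding s(3) by (simp_all add: algebra_simps)
  then show ?thesis
    using s(1,2) by (cases "s = 0"; cases "s = 1") (auto simp: complex_eq_iff)
qed

lemma edge_path_eq:
  assumes "u < v"
  shows "edge_path {u, v} = (if v = 4 * u then linepath (vertex_pt u) (bend u) +++ linepath (bend u) (vertex_pt v)
    else linepath (vertex_pt u) (vertex_pt v))"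
proof -
  have "Min {u, v} = u" "Max {u, v} = v" using assms by auto
  then show ?thesis by (simp only: edge_path_def Let_def)
qed

lemma edge_path_props:
  assumes u: "n \<le> u" and k: "2 \<le> k" "k \<le> 6" and um: "k * u \<le> m"
  shows "arc (edge_path {u, k * u})" "pathstart (edge_path {u, k * u}) = vertex_pt u"
    "pathfinish (edge_path {u, k * u}) = vertex_pt (k * u)"
    "path_image (edge_path {u, k * u}) \<subseteq> {z. z = vertex_pt u \<or> z = vertex_pt (k * u) \<or> edge_interior u k z}"
proof -
  have u0: "u > 0" using u n by simp
  have lt: "u < k * u"
  proof -
    have "1 * u < k * u" using u0 k by (intro mult_strict_right_mono) auto
    then show ?thesis by (simp only: mult_1)
  qed
  have ep: "edge_path {u, k * u} = (if k = 4 then linepath (vertex_pt u) (bend u) +++ linepath (bend u) (vertex_pt (k * u))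
      else linepath (vertex_pt u) (vertex_pt (k * u)))"
  proof -
    have "k * u = 4 * u \<longleftrightarrow> k = 4" using u0 by simp
    then show ?thesis unfolding edge_path_eq[OF lt] by (rule if_cong) (rule refl)+
  qed
  have ne: "vertex_pt u \<noteq> vertex_pt (k * u)"
  proof
    assume "vertex_pt u = vertex_pt (k * u)"
    moreover have "u \<in> {n..m}" "k * u \<in> {n..m}" using u lt um by auto
    ultimately have "u = k * u" by (rule inj_onD[OF inj_on_pt])
    then show False using lt by linarith
  qed
  consider "k = 4" | "k = 2" | "k = 3" | "k = 5" | "k = 6" using k by force
  note k' = this
  show "pathstart (edge_path {u, k * u}) = vertex_pt u" "pathfinish (edge_path {u, k * u}) = vertex_pt (k * u)"
    by (auto simp: ep)
  have u4: "vertex_pt (4 * u) = Complex (real_of_int (xpos m u) + 2) (ypos u)"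
    using pos_steps[of u] u0 by (simp add: vertex_pt_def)
  show "arc (edge_path {u, k * u})"
  proof (cases "k = 4")
    case True
    have b: "vertex_pt u \<noteq> bend u" "bend u \<noteq> vertex_pt (4 * u)"
      unfolding u4 by (simp_all add: bend_def vertex_pt_def)
    have "closed_segment (vertex_pt u) (bend u) \<inter> closed_segment (bend u) (vertex_pt (4 * u)) \<subseteq> {bend u}"
    proof
      fix z assume z: "z \<in> closed_segment (vertex_pt u) (bend u) \<inter> closed_segment (bend u) (vertex_pt (4 * u))"
      then have z1: "z \<in> closed_segment (Complex (xpos m u) (ypos u)) (Complex (real_of_int (xpos m u) + 1) (ypos u + bend_side u / 4))"
        unfolding bend_def vertex_pt_def by blast
      have z2: "z \<in> closed_segment (Complex (real_of_int (xpos m u) + 1) (ypos u + bend_side u / 4)) (Complex (real_of_int (xpos m u) + 2) (ypos u))"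
        using z unfolding u4 bend_def by blast
      show "z \<in> {bend u}"
        using linepath_split[OF z1] linepath_split[OF z2] by (auto simp: bend_def complex_eq_iff)
    qed
    then show ?thesis
      unfolding ep using b True by (auto intro!: arc_join)
  next
    case False
    then show ?thesis unfolding ep using ne by simp
  qed
  show "path_image (edge_path {u, k * u}) \<subseteq> {z. z = vertex_pt u \<or> z = vertex_pt (k * u) \<or> edge_interior u k z}"
    using k'
  proof cases
    case 1
    have "edge_interior u k z \<or> z = vertex_pt u \<or> z = vertex_pt (4 * u)"
      if z: "z \<in> closed_segment (vertex_pt u) (bend u) \<or> z \<in> closed_segment (bend u) (vertex_pt (4 * u))" for z
      using z
    proof
      assume "z \<in> closed_segment (vertex_pt u) (bend u)"
      then have "z \<in> closed_segment (Complex (xpos m u) (ypos u)) (Complex (real_of_int (xpos m u) + 1) (ypos u + bend_side u / 4))"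
        unfolding bend_def vertex_pt_def .
      from linepath_split[OF this] show ?thesis
      proof (elim disjE exE conjE)
        assume "z = Complex (xpos m u) (ypos u)"
        then show ?thesis by (simp add: vertex_pt_def)
      next
        assume "z = Complex (real_of_int (xpos m u) + 1) (ypos u + bend_side u / 4)"
        then have "\<exists>s :: real. 0 < s \<and> s < 2 \<and> Re z = xpos m u + s \<and> Im z = ypos u + bend_side u * (1 - \<bar>s - 1\<bar>) / 4"
          by (intro exI[of _ 1]) simp
        then show ?thesis using 1 unfolding edge_interior_def by blast
      next
        fix s :: real assume "0 < s" "s < 1" "Re z = xpos m u + s * (real_of_int (xpos m u) + 1 - xpos m u)"
          "Im z = ypos u + s * (ypos u + bend_side u / 4 - ypos u)"
        then have "\<exists>s :: real. 0 < s \<and> s < 2 \<and> Re z = xpos m u + s \<and> Im z = ypos u + bend_side u * (1 - \<bar>s - 1\<bar>) / 4"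
          by (intro exI[of _ s]) (simp add: abs_if mult.commute)
        then show ?thesis using 1 unfolding edge_interior_def by blast
      qed
    next
      assume "z \<in> closed_segment (bend u) (vertex_pt (4 * u))"
      then have "z \<in> closed_segment (Complex (real_of_int (xpos m u) + 1) (ypos u + bend_side u / 4)) (Complex (real_of_int (xpos m u) + 2) (ypos u))"
        unfolding bend_def u4 .
      from linepath_split[OF this] show ?thesis
      proof (elim disjE exE conjE)
        assume "z = Complex (real_of_int (xpos m u) + 2) (ypos u)"
        then show ?thesis by (simp add: u4)
      next
        assume "z = Complex (real_of_int (xpos m u) + 1) (ypos u + bend_side u / 4)"
        then have "\<exists>s :: real. 0 < s \<and> s < 2 \<and> Re z = xpos m u + s \<and> Im z = ypos u + bend_side u * (1 - \<bar>s - 1\<bar>) / 4"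
          by (intro exI[of _ 1]) simp
        then show ?thesis using 1 unfolding edge_interior_def by blast
      next
        fix s :: real assume "0 < s" "s < 1" "Re z = real_of_int (xpos m u) + 1 + s * (real_of_int (xpos m u) + 2 - (real_of_int (xpos m u) + 1))"
          "Im z = ypos u + bend_side u / 4 + s * (ypos u - (ypos u + bend_side u / 4))"
        then have "\<exists>s :: real. 0 < s \<and> s < 2 \<and> Re z = xpos m u + s \<and> Im z = ypos u + bend_side u * (1 - \<bar>s - 1\<bar>) / 4"
          by (intro exI[of _ "1 + s"]) (simp add: abs_if algebra_simps diff_divide_distrib)
        then show ?thesis using 1 unfolding edge_interior_def by blast
      qed
    qed
    moreover have "path_image (edge_path {u, k * u}) = closed_segment (vertex_pt u) (bend u) \<union> closed_segment (bend u) (vertex_pt (4 * u))"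
      unfolding ep using 1 by (simp add: path_image_join)
    ultimately show ?thesis using 1 by blast
  next
    case 2
    show ?thesis
    proof
      fix z assume "z \<in> path_image (edge_path {u, k * u})"
      then show "z \<in> {z. z = vertex_pt u \<or> z = vertex_pt (k * u) \<or> edge_interior u k z}"
        using 2 linepath_split[of z "xpos m u" "ypos u" "real_of_int (xpos m u) + 1" "ypos u"] pos_steps[of u] u0
        unfolding ep by (auto simp: vertex_pt_def edge_interior_def)
    qed
  next
    case 3
    show ?thesis
    proof
      fix z assume "z \<in> path_image (edge_path {u, k * u})"
      then show "z \<in> {z. z = vertex_pt u \<or> z = vertex_pt (k * u) \<or> edge_interior u k z}"
        using 3 linepath_split[of z "xpos m u" "ypos u" "xpos m u" "real_of_int (ypos u) + 1"] pos_steps[of u] u0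
        unfolding ep by (auto simp: vertex_pt_def edge_interior_def)
    qed
  next
    case 4
    show ?thesis
    proof
      fix z assume "z \<in> path_image (edge_path {u, k * u})"
      then show "z \<in> {z. z = vertex_pt u \<or> z = vertex_pt (k * u) \<or> edge_interior u k z}"
        using 4 linepath_split[of z "xpos m u" "ypos u" "real_of_int (xpos m u) - 1" "real_of_int (ypos u) - 1"] pos_steps[of u] u0
        unfolding ep by (auto simp: vertex_pt_def edge_interior_def)
    qed
  next
    case 5
    show ?thesis
    proof
      fix z assume "z \<in> path_image (edge_path {u, k * u})"
      then show "z \<in> {z. z = vertex_pt u \<or> z = vertex_pt (k * u) \<or> edge_interior u k z}"
        using 5 linepath_split[of z "xpos m u" "ypos u" "real_of_int (xpos m u) + 1" "real_of_int (ypos u) + 1"] pos_steps[of u] u0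
        unfolding ep by (auto simp: vertex_pt_def edge_interior_def)
    qed
  qed
qed

text \<open>Fractional parts reveal the direction, floors the starting point. Quotient 5 leads down
  and left, hence the shift by 1. Quotients 5 and 6 share a direction and are not told apart
  here.\<close>

lemma floor_unit_edge:
  assumes "edge_interior u k z" "k \<noteq> 4"
  shows "\<lfloor>Re z\<rfloor> = xpos m u - (if k = 5 then 1 else 0)" "\<lfloor>Im z\<rfloor> = ypos u - (if k = 5 then 1 else 0)"
    "frac (Re z) = 0 \<longleftrightarrow> k = 3" "frac (Im z) = 0 \<longleftrightarrow> k = 2"
    "k = 5 \<or> k = 6 \<Longrightarrow> frac (Re z) = frac (Im z)" "k \<in> {2, 3, 5, 6}"
proof -
  have k: "k = 2 \<or> k = 3 \<or> k = 5 \<or> k = 6" using assms by (auto simp: edge_interior_def)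
  then show "k \<in> {2, 3, 5, 6}" by auto
  show 1: "\<lfloor>Re z\<rfloor> = xpos m u - (if k = 5 then 1 else 0)" and 2: "\<lfloor>Im z\<rfloor> = ypos u - (if k = 5 then 1 else 0)"
    using assms by (auto simp: edge_interior_def floor_eq_iff)
  show "frac (Re z) = 0 \<longleftrightarrow> k = 3" "frac (Im z) = 0 \<longleftrightarrow> k = 2"
    "k = 5 \<or> k = 6 \<Longrightarrow> frac (Re z) = frac (Im z)"
    unfolding frac_def 1 2 using assms k by (auto simp: edge_interior_def)
qed

text \<open>The last two alternatives are the halves before and after the bend; the bend itself, at
  \<open>s = 1\<close>, belongs to the second.\<close>

lemma floor_bent_edge:
  assumes "edge_interior u 4 z"
  shows "frac (Im z) > 0" "frac (Im z) < 1 / 2 \<longleftrightarrow> bend_side u = 1"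
    "\<lfloor>Im z\<rfloor> = ypos u - (if bend_side u = 1 then 0 else 1)"
    "\<lfloor>Re z\<rfloor> = xpos m u \<and> frac (Re z) > 0 \<and>
        4 * frac (Im z) = (if bend_side u = 1 then frac (Re z) else 4 - frac (Re z)) \<or>
     \<lfloor>Re z\<rfloor> = xpos m u + 1 \<and>
        4 * frac (Im z) = (if bend_side u = 1 then 1 - frac (Re z) else 3 + frac (Re z))"
proof -
  obtain s :: real where s: "0 < s" "s < 2" "Re z = xpos m u + s" "Im z = ypos u + bend_side u * (1 - \<bar>s - 1\<bar>) / 4"
    using assms by (auto simp: edge_interior_def)
  define h where "h = (1 - \<bar>s - 1\<bar>) / 4"
  have h: "0 < h" "h \<le> 1 / 4" using s by (auto simp: h_def)
  have im: "Im z = ypos u + bend_side u * h" using s by (simp add: h_def)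
  show fl: "\<lfloor>Im z\<rfloor> = ypos u - (if bend_side u = 1 then 0 else 1)"
    using bend_side_cases[of u] h im by (auto simp: floor_eq_iff)
  have fi: "frac (Im z) = (if bend_side u = 1 then h else 1 - h)"
    unfolding frac_def fl using bend_side_cases[of u] im by auto
  show "frac (Im z) > 0" "frac (Im z) < 1 / 2 \<longleftrightarrow> bend_side u = 1" using fi h by auto
  show "\<lfloor>Re z\<rfloor> = xpos m u \<and> frac (Re z) > 0 \<and>
        4 * frac (Im z) = (if bend_side u = 1 then frac (Re z) else 4 - frac (Re z)) \<or>
     \<lfloor>Re z\<rfloor> = xpos m u + 1 \<and>
        4 * frac (Im z) = (if bend_side u = 1 then 1 - frac (Re z) else 3 + frac (Re z))"
  proof (cases "s < 1")
    case True
    then have fr: "\<lfloor>Re z\<rfloor> = xpos m u" using s by (auto simp: floor_eq_iff)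
    moreover have "frac (Re z) = s" unfolding frac_def fr using s by simp
    moreover have "4 * h = s" using True by (simp add: h_def)
    ultimately show ?thesis using s fi by auto
  next
    case False
    then have fr: "\<lfloor>Re z\<rfloor> = xpos m u + 1" using s by (auto simp: floor_eq_iff)
    moreover have "frac (Re z) = s - 1" unfolding frac_def fr using s by simp
    moreover have "4 * h = 2 - s" using False by (simp add: h_def)
    ultimately show ?thesis using fi by auto
  qed
qed

lemma edge_interior_no_vertex:
  assumes "edge_interior u k z"
  shows "z \<noteq> vertex_pt v"
proof (cases "k = 4")
  case True
  then show ?thesis using floor_bent_edge(1) assms by (force simp: vertex_pt_def)
next
  case False
  then show ?thesis
    using floor_unit_edge[OF assms False] by (auto simp: vertex_pt_def)
qed

text \<open>
  A bent edge \<open>u\<close>--\<open>4 * u\<close> passes the lattice point of \<open>2 * u\<close> on the side where no edge is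
  attached: below, the point of \<open>2 * u / 3\<close> is vacant for \<open>2 * u < 3 * n\<close>, and above, the point
  of \<open>6 * u\<close> is vacant otherwise.
\<close>

lemma bent_unit_disjoint:
  assumes u: "n \<le> u" "4 * u \<le> m" and u': "n \<le> u'" "k * u' \<le> m"
    and e: "edge_interior u 4 z" "edge_interior u' k z" "k \<noteq> 4"
  shows False
proof -
  have pos: "u > 0" "u' > 0" using u u' n by auto
  note b = floor_bent_edge[OF e(1)] and c = floor_unit_edge[OF e(2,3)]
  have "u \<noteq> 0" "u' \<noteq> 0" using pos by simp_all
  note su = pos_steps[OF \<open>u \<noteq> 0\<close>] and su' = pos_steps[OF \<open>u' \<noteq> 0\<close>]
  have bend_up: "bend_side u = 1 \<longleftrightarrow> 3 * n \<le> 2 * u" by (simp add: bend_side_def)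
  have f: "0 \<le> frac (Re z)" "frac (Re z) < 1" by (auto intro: frac_lt_1)
  \<comment> \<open>In every case below a crossing puts \<open>u'\<close> or \<open>k * u'\<close>
    on the lattice point of \<open>2 * u\<close>, which makes them equal and contradicts the size of
    the window or the choice of \<open>bend_side\<close>.\<close>
  have eqI: "v = 2 * u" if "n \<le> v" "v \<le> m" "xpos m v = xpos m u + 1" "ypos v = ypos u" for v
  proof (rule pt_inj)
    show "v \<in> {n..m}" "2 * u \<in> {n..m}" using that(1,2) pos u by auto
    show "xpos m v = xpos m (2 * u)" "ypos v = ypos (2 * u)" using that(3,4) su(1,2) by simp_all
  qed
  have "k \<noteq> 2" using c(4) b(1) by auto
  then consider "k = 3" | "k = 5" | "k = 6" using c(6) by blast
  then show False
  proof cases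
    case 1
    then have re: "xpos m u' = xpos m u + 1" using b(4) c by auto
    show False
    proof (cases "bend_side u = 1")
      case True
      then have "u' = 2 * u" using re b(3) c 1 u' pos by (intro eqI) auto
      then show False using True bend_up u' 1 nm n by simp
    next
      case False
      then have "3 * u' = 2 * u" using re b(3) c 1 u' pos su' by (intro eqI) auto
      then show False using False bend_up u' by simp
    qed
  next
    case 2
    \<comment> \<open>Equal fractional parts are compatible with only one half of the bent edge,
      which fixes the floor of \<open>Re z\<close>.\<close>
    then have fr: "frac (Im z) = frac (Re z)" using c by simp
    show False
    proof (cases "bend_side u = 1")
      case True
      then have "\<lfloor>Re z\<rfloor> = xpos m u + 1" using b(4) fr f by auto
      then have "5 * u' = 2 * u" using True b(3) c 2 u' pos su' by (intro eqI) auto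
      then show False using u u' nm n by simp
    next
      case False
      then have "\<lfloor>Re z\<rfloor> = xpos m u" using b(4) fr f by auto
      then have "u' = 2 * u" using False b(3) c 2 u' pos by (intro eqI) auto
      then show False using u u' 2 nm n by simp
    qed
  next
    case 3
    then have fr: "frac (Im z) = frac (Re z)" using c by simp
    show False
    proof (cases "bend_side u = 1")
      case True
      then have "\<lfloor>Re z\<rfloor> = xpos m u + 1" using b(4) fr f by auto
      then have "u' = 2 * u" using True b(3) c 3 u' pos by (intro eqI) auto
      then show False using u u' 3 nm n by simp
    next
      case False
      then have "\<lfloor>Re z\<rfloor> = xpos m u" using b(4) fr f by auto
      then have "6 * u' = 2 * u" using False b(3) c 3 u' pos su' by (intro eqI) auto
      then show False using u u' 3 nm n by simp
    qed
  qed
qed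

text \<open>Crossing bends lie on the same side of the same row, and their starting points coincide
  or are one step apart. In the latter case one start is twice the other, and 8 times the smaller
  one exceeds \<open>m\<close>.\<close>

lemma bent_bent_disjoint:
  assumes u: "n \<le> u" "4 * u \<le> m" and u': "n \<le> u'" "4 * u' \<le> m"
    and e: "edge_interior u 4 z" "edge_interior u' 4 z"
  shows "u = u'"
proof -
  have f: "0 \<le> frac (Re z)" "frac (Re z) < 1" by (auto intro: frac_lt_1)
  note b = floor_bent_edge[OF e(1)] and c = floor_bent_edge[OF e(2)]
  have s: "bend_side u = bend_side u'"
    using b(2) c(2) bend_side_cases[of u] bend_side_cases[of u'] by auto
  then have y: "ypos u = ypos u'" using b(3) c(3) s by simp
  have step: "v' \<noteq> 2 * v" if "n \<le> v" "4 * v' \<le> m" for v v'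
    using that nm n by auto
  have "xpos m u' \<noteq> xpos m u + 1"
    using pt_inj[of u' "2 * u"] pos_steps[of u] step[of u u'] u u' n y by auto
  moreover have "xpos m u \<noteq> xpos m u' + 1"
    using pt_inj[of u "2 * u'"] pos_steps[of u'] step[of u' u] u u' n y by auto
  ultimately have "xpos m u = xpos m u'" using b(4) c(4) by auto
  then show ?thesis using pt_inj y u u' n by auto
qed

lemma edge_interiors_disjoint:
  assumes u: "n \<le> u" "k * u \<le> m" and u': "n \<le> u'" "k' * u' \<le> m"
    and e: "edge_interior u k z" "edge_interior u' k' z"
  shows "u = u' \<and> k = k'"
proof (cases "k = 4 \<or> k' = 4")
  case True
  then show ?thesis
    using bent_bent_disjoint[of u u' z] bent_unit_disjoint[of u u' k' z] bent_unit_disjoint[of u' u k z]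
      u u' e by (cases "k = 4"; cases "k' = 4") auto
next
  case False
  then have k4: "k \<noteq> 4" "k' \<noteq> 4" by auto
  note b = floor_unit_edge[OF e(1) k4(1)] and c = floor_unit_edge[OF e(2) k4(2)]
  have pos: "u > 0" "u' > 0" using u u' n by auto
  have le: "u \<le> m" "u' \<le> m"
  proof -
    have "1 * u \<le> k * u" "1 * u' \<le> k' * u'" using b(6) c(6) pos by (intro mult_right_mono; auto)+
    then show "u \<le> m" "u' \<le> m" using u u' by auto
  qed
  \<comment> \<open>The edge of quotient 5 from \<open>v\<close> would coincide with the edge of
    quotient 6 from \<open>v' = 5 * v\<close>, but then \<open>6 * v' = 30 * v\<close> exceeds
    \<open>m\<close>.\<close>
  have diag: "5 * v \<noteq> v'" if "n \<le> v" "6 * v' \<le> m" for v v'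
    using that nm n by auto
  show ?thesis
  proof (cases "k = k'")
    case True
    have "xpos m u = xpos m u'" "ypos u = ypos u'"
      using trans[OF b(1)[symmetric] c(1)] trans[OF b(2)[symmetric] c(2)] unfolding True by simp_all
    moreover have "u \<in> {n..m}" "u' \<in> {n..m}" using le u u' by auto
    ultimately show ?thesis using pt_inj True by blast
  next
    case False
    moreover have "k = 3 \<longleftrightarrow> k' = 3" "k = 2 \<longleftrightarrow> k' = 2" using b(3,4) c(3,4) by blast+
    ultimately have "k = 5 \<and> k' = 6 \<or> k = 6 \<and> k' = 5" using b(6) c(6) by blast
    then show ?thesis
    proof
      assume k: "k = 5 \<and> k' = 6"
      have "5 * u = u'"
      proof (rule pt_inj)
        show "5 * u \<in> {n..m}" "u' \<in> {n..m}" using u u' le pos k by auto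
        have "u \<noteq> 0" using pos by simp
        note pos_steps[OF this]
        then show "xpos m (5 * u) = xpos m u'" "ypos (5 * u) = ypos u'"
          using trans[OF b(1)[symmetric] c(1)] trans[OF b(2)[symmetric] c(2)] k by simp_all
      qed
      then show ?thesis using diag[of u u'] diag[of u' u] u u' k by simp
    next
      assume k: "k = 6 \<and> k' = 5"
      have "5 * u' = u"
      proof (rule pt_inj)
        show "5 * u' \<in> {n..m}" "u \<in> {n..m}" using u u' le pos k by auto
        have "u' \<noteq> 0" using pos by simp
        note pos_steps[OF this]
        then show "xpos m (5 * u') = xpos m u" "ypos (5 * u') = ypos u"
          using trans[OF b(1)[symmetric] c(1)] trans[OF b(2)[symmetric] c(2)] k by simp_all
      qed
      then show ?thesis using diag[of u u'] diag[of u' u] u u' k by simp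
    qed
  qed
qed

lemma lattice_edge_subset: "e \<in> lattice_edges n m \<Longrightarrow> e \<subseteq> {n..m} \<and> card e = 2"
proof -
  assume "e \<in> lattice_edges n m"
  then obtain u k where e: "e = {u, k * u}" "n \<le> u" "2 \<le> k" "k * u \<le> m"
    by (auto simp: lattice_edges_def)
  have "1 * u < k * u" using e n by (intro mult_strict_right_mono) auto
  then have lt: "u < k * u" by (simp only: mult_1)
  then have "card e = 2" unfolding e(1) card_2_iff by (metis less_irrefl)
  then show ?thesis using e lt by auto
qed

lemma lattice_drawing:
  "plane_drawing \<lparr>verts = {n..m}, edges = lattice_edges n m\<rparr> vertex_pt edge_path"
proof -
  have ends: "vertex_pt ` e \<subseteq> path_image (edge_path e)" if "e \<in> lattice_edges n m" for e
  proof -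
    from that obtain u k where e: "e = {u, k * u}" "n \<le> u" "2 \<le> k" "k \<le> 6" "k * u \<le> m"
      by (auto simp: lattice_edges_def)
    then show ?thesis
      using edge_path_props[of u k] pathstart_in_path_image[of "edge_path e"]
        pathfinish_in_path_image[of "edge_path e"] by auto
  qed
  have interior: "\<exists>u k. e = {u, k * u} \<and> n \<le> u \<and> k * u \<le> m \<and> edge_interior u k z"
    if "e \<in> lattice_edges n m" "z \<in> path_image (edge_path e)" "z \<notin> vertex_pt ` e" for e z
  proof -
    from that obtain u k where e: "e = {u, k * u}" "n \<le> u" "2 \<le> k" "k \<le> 6" "k * u \<le> m"
      by (auto simp: lattice_edges_def)
    then show ?thesis
      using edge_path_props(4)[of u k] that by blast
  qed
  have noV: "z \<notin> vertex_pt ` V" if "edge_interior u k z" for z u k V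
    using edge_interior_no_vertex[OF that] by blast
  have evert: "path_image (edge_path e) \<inter> vertex_pt ` {n..m} = vertex_pt ` e" if e: "e \<in> lattice_edges n m" for e
  proof
    show "path_image (edge_path e) \<inter> vertex_pt ` {n..m} \<subseteq> vertex_pt ` e"
      using interior[OF e] noV by blast
    show "vertex_pt ` e \<subseteq> path_image (edge_path e) \<inter> vertex_pt ` {n..m}"
      using ends[OF e] lattice_edge_subset[OF e] by blast
  qed
  have ee: "path_image (edge_path e) \<inter> path_image (edge_path f) = vertex_pt ` (e \<inter> f)"
    if e: "e \<in> lattice_edges n m" and f: "f \<in> lattice_edges n m" and ef: "e \<noteq> f" for e f
  proof -
    have img: "vertex_pt ` (e \<inter> f) = vertex_pt ` e \<inter> vertex_pt ` f"
      using inj_on_image_Int[OF inj_on_pt] lattice_edge_subset[OF e] lattice_edge_subset[OF f] by blast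
    have "z \<in> vertex_pt ` e" if z: "z \<in> path_image (edge_path e)" "z \<in> path_image (edge_path f)"
      and e: "e \<in> lattice_edges n m" and f: "f \<in> lattice_edges n m" and ef: "e \<noteq> f" for z e f
    proof (rule ccontr)
      assume ze: "z \<notin> vertex_pt ` e"
      obtain u k where u: "e = {u, k * u}" "n \<le> u" "k * u \<le> m" "edge_interior u k z"
        using interior[OF e z(1) ze] by blast
      have "z \<notin> vertex_pt ` f" using noV[OF u(4)] .
      then obtain u' k' where u': "f = {u', k' * u'}" "n \<le> u'" "k' * u' \<le> m" "edge_interior u' k' z"
        using interior[OF f z(2)] by blast
      show False using edge_interiors_disjoint[OF u(2,3) u'(2,3) u(4) u'(4)] u(1) u'(1) ef by blast
    qed
    from this[OF _ _ e f ef] this[OF _ _ f e] ef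
    show ?thesis using ends[OF e] ends[OF f] img by blast
  qed
  show ?thesis
    unfolding plane_drawing_def graph.simps
  proof (intro conjI ballI impI)
    show "inj_on vertex_pt {n..m}" by (rule inj_on_pt)
    show "path_image (edge_path e) \<inter> vertex_pt ` {n..m} = vertex_pt ` e" if "e \<in> lattice_edges n m" for e
      using evert[OF that] .
    show "path_image (edge_path e) \<inter> path_image (edge_path f) = vertex_pt ` (e \<inter> f)"
      if "e \<in> lattice_edges n m" "f \<in> lattice_edges n m" "e \<noteq> f" for e f
      using ee[OF that] .
    fix e assume "e \<in> lattice_edges n m"
    then obtain u k where e: "e = {u, k * u}" "n \<le> u" "2 \<le> k" "k \<le> 6" "k * u \<le> m"
      by (auto simp: lattice_edges_def)
    then show "arc (edge_path e)" "{pathstart (edge_path e), pathfinish (edge_path e)} = vertex_pt ` e"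
      using edge_path_props[of u k] by auto
  qed
qed

lemma simple_lattice_graph: "simple_graph \<lparr>verts = {n..m}, edges = lattice_edges n m\<rparr>"
  using lattice_edge_subset by (simp add: simple_graph_def)

text \<open>
  In the drawing the lattice points to the left of \<open>n\<close> and to the right of \<open>7 * n\<close> are vacant.
\<close>

lemma lattice_join_7:
  assumes m: "m = 7 * n"
  shows "planar \<lparr>verts = {n..m}, edges = insert {n, m} (lattice_edges n m)\<rparr>"
proof -
  let ?G = "\<lparr>verts = {n..m}, edges = lattice_edges n m\<rparr>"
  \<comment> \<open>The whole sheet of \<open>7 * n\<close>; it does not contain \<open>n\<close>,
    as \<open>core (7 * n) = 7 * core n\<close>.\<close>
  let ?B = "{v \<in> {n..m}. core v = core m}"
  let ?A = "{n..m} - ?B"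
  have core_n: "core n \<noteq> core m"
    using core_times(4)[of n] core_decomposition[of n] n m by auto
  have core_edge: "core (k * u) = core u" if k: "2 \<le> k" "k \<le> 6" and u: "u \<noteq> 0" for k u
  proof -
    have "k = 2 \<or> k = 3 \<or> k = 4 \<or> k = 5 \<or> k = 6" using k by presburger
    then show ?thesis
      using core_times[OF u] core_times[of "2 * u"] core_times[of "3 * u"] u
      by (elim disjE) simp_all
  qed
  have comp: "e \<subseteq> ?A \<or> e \<subseteq> ?B" if "e \<in> edges ?G" for e
  proof -
    have e': "e \<in> lattice_edges n m" using that by simp
    then obtain u k where e: "e = {u, k * u}" "n \<le> u" "2 \<le> k" "k \<le> 6" "k * u \<le> m"
      by (auto simp: lattice_edges_def)
    then show ?thesis using core_edge[of k u] lattice_edge_subset[OF e'] n by auto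
  qed
  \<comment> \<open>A point with integral imaginary and non-integral real part can lie only on an
    edge of quotient 2, so it is free if no such edge starts at the lattice point to its
    left.\<close>
  have free: "False" if z: "Im z = ypos v" "frac (Re z) > 0" "z \<in> drawn ?G vertex_pt edge_path V"
      and vac: "\<And>u. n \<le> u \<Longrightarrow> 2 * u \<le> m \<Longrightarrow> \<lfloor>Re z\<rfloor> = xpos m u \<Longrightarrow> ypos u = ypos v \<Longrightarrow> False" for z v V
  proof -
    have novert: "z \<noteq> vertex_pt w" for w using z by (auto simp: vertex_pt_def)
    then obtain e where e: "e \<in> lattice_edges n m" "z \<in> path_image (edge_path e)"
      using z(3) by (auto simp: drawn_def)
    then obtain u k where u: "e = {u, k * u}" "n \<le> u" "2 \<le> k" "k \<le> 6" "k * u \<le> m"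
      by (auto simp: lattice_edges_def)
    then have ei: "edge_interior u k z"
      using edge_path_props(4)[of u k] e novert by blast
    have f0: "frac (Im z) = 0" using z by simp
    have "k \<noteq> 4" using floor_bent_edge(1)[of u z] ei f0 by auto
    note c = floor_unit_edge[OF ei this]
    have "k = 2" using c(4) f0 by simp
    then show False using c(1,2) z vac[of u] u by simp
  qed
  have seg: "\<exists>s. 0 \<le> s \<and> s \<le> 1 \<and> z = Complex (a + s * (b - a)) y"
    if "z \<in> closed_segment (Complex a y) (Complex b y)" for z a b y
    using that by (auto simp: closed_segment_def complex_eq_iff algebra_simps)
  \<comment> \<open>Half a step towards the lattice point of \<open>n / 2\<close>: an edge of
    quotient 2 met there would end at \<open>n\<close> and start below the window.\<close>
  have segn: "closed_segment (Complex (xpos m n - 1/2) (ypos n)) (vertex_pt n) \<inter> drawn ?G vertex_pt edge_path ?A = {vertex_pt n}"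
  proof
    show "{vertex_pt n} \<subseteq> closed_segment (Complex (xpos m n - 1/2) (ypos n)) (vertex_pt n) \<inter> drawn ?G vertex_pt edge_path ?A"
      using core_n n m by (auto simp: drawn_def)
    show "closed_segment (Complex (xpos m n - 1/2) (ypos n)) (vertex_pt n) \<inter> drawn ?G vertex_pt edge_path ?A \<subseteq> {vertex_pt n}"
    proof
      fix z assume z: "z \<in> closed_segment (Complex (xpos m n - 1/2) (ypos n)) (vertex_pt n) \<inter> drawn ?G vertex_pt edge_path ?A"
      then obtain s where s: "0 \<le> s" "s \<le> 1" "z = Complex (xpos m n - 1/2 + s * (xpos m n - (xpos m n - 1/2))) (ypos n)"
        using seg unfolding vertex_pt_def by blast
      show "z \<in> {vertex_pt n}"
      proof (rule ccontr)
        assume "z \<notin> {vertex_pt n}"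
        then have "s < 1" using s by (cases "s = 1") (auto simp: vertex_pt_def)
        then have fl: "\<lfloor>Re z\<rfloor> = xpos m n - 1" using s by (auto simp: floor_eq_iff)
        then have "frac (Re z) > 0" unfolding frac_def using s by simp
        then show False
        proof (rule free[rotated])
          show "z \<in> drawn ?G vertex_pt edge_path ?A" using z by blast
          show "Im z = ypos n" unfolding s(3) by simp
          fix u assume u: "n \<le> u" "2 * u \<le> m" "\<lfloor>Re z\<rfloor> = xpos m u" "ypos u = ypos n"
          have "2 * u = n"
          proof (rule pt_inj)
            show "2 * u \<in> {n..m}" "n \<in> {n..m}" using u(1,2) n by auto
            have "u \<noteq> 0" using u n by simp
            then show "xpos m (2 * u) = xpos m n" "ypos (2 * u) = ypos n"
              using pos_steps(1,2)[of u] u(3,4) fl by simp_all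
          qed
          then show False using u n by simp
        qed
      qed
    qed
  qed
  \<comment> \<open>An edge of quotient 2 met here would start at \<open>m\<close> and end above the
    window.\<close>
  have segm: "closed_segment (Complex (xpos m m + 1/2) (ypos m)) (vertex_pt m) \<inter> drawn ?G vertex_pt edge_path ?B = {vertex_pt m}"
  proof
    show "{vertex_pt m} \<subseteq> closed_segment (Complex (xpos m m + 1/2) (ypos m)) (vertex_pt m) \<inter> drawn ?G vertex_pt edge_path ?B"
      using n m by (auto simp: drawn_def)
    show "closed_segment (Complex (xpos m m + 1/2) (ypos m)) (vertex_pt m) \<inter> drawn ?G vertex_pt edge_path ?B \<subseteq> {vertex_pt m}"
    proof
      fix z assume z: "z \<in> closed_segment (Complex (xpos m m + 1/2) (ypos m)) (vertex_pt m) \<inter> drawn ?G vertex_pt edge_path ?B"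
      then obtain s where s: "0 \<le> s" "s \<le> 1" "z = Complex (xpos m m + 1/2 + s * (xpos m m - (xpos m m + 1/2))) (ypos m)"
        using seg unfolding vertex_pt_def by blast
      show "z \<in> {vertex_pt m}"
      proof (rule ccontr)
        assume "z \<notin> {vertex_pt m}"
        then have "s < 1" using s by (cases "s = 1") (auto simp: vertex_pt_def)
        then have fl: "\<lfloor>Re z\<rfloor> = xpos m m" using s by (auto simp: floor_eq_iff)
        then have "frac (Re z) > 0" unfolding frac_def using s \<open>s < 1\<close> by simp
        then show False
        proof (rule free[rotated])
          show "z \<in> drawn ?G vertex_pt edge_path ?B" using z by blast
          show "Im z = ypos m" unfolding s(3) by simp
          fix u assume u: "n \<le> u" "2 * u \<le> m" "\<lfloor>Re z\<rfloor> = xpos m u" "ypos u = ypos m"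
          have "u = m"
          proof (rule pt_inj)
            show "u \<in> {n..m}" "m \<in> {n..m}" using u(1,2) n m by auto
            show "xpos m u = xpos m m" "ypos u = ypos m" using u(3,4) fl by simp_all
          qed
          then show False using u n m by simp
        qed
      qed
    qed
  qed
  have "planar \<lparr>verts = verts ?G, edges = insert {n, m} (edges ?G)\<rparr>"
  proof (rule planar_join_components[OF lattice_drawing simple_lattice_graph])
    show "verts ?G = ?A \<union> ?B" "?A \<inter> ?B = {}" "finite (verts ?G)" by auto
    show "e \<subseteq> ?A \<or> e \<subseteq> ?B" if "e \<in> edges ?G" for e using comp[OF that] .
    show "n \<in> ?A" "m \<in> ?B" using core_n n m by auto
    show "Complex (xpos m n - 1/2) (ypos n) \<noteq> vertex_pt n" "Complex (xpos m m + 1/2) (ypos m) \<noteq> vertex_pt m"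
      by (auto simp: vertex_pt_def)
  qed (rule segn segm)+
  then show ?thesis by simp
qed

end

text \<open>A quotient of at least 7 gives
  \<open>7 * n \<le> 7 * u \<le> v \<le> m \<le> 7 * n\<close>, hence equality throughout.\<close>

lemma divisor_graph_lattice_edges:
  assumes n: "0 < n" and nm: "n \<le> m" "m \<le> 7 * n"
  shows "divisor_graph n m = \<lparr>verts = {n..m},
    edges = (if m = 7 * n then insert {n, m} (lattice_edges n m) else lattice_edges n m)\<rparr>"
proof -
  let ?E = "if m = 7 * n then insert {n, m} (lattice_edges n m) else lattice_edges n m"
  have key: "{u, v} \<in> ?E" if uv: "u \<in> {n..m}" "v \<in> {n..m}" "u \<noteq> v" "u dvd v" for u v
  proof -
    obtain k where k: "v = u * k" using uv(4) by blast
    have pos: "u > 0" "v > 0" using uv n by auto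
    then have "k > 0" using k by (simp add: zero_less_mult_iff)
    moreover have "k \<noteq> 1" using k uv by auto
    ultimately have k2: "2 \<le> k" by simp
    show ?thesis
    proof (cases "k \<le> 6")
      case True
      then have "{u, v} \<in> lattice_edges n m"
        unfolding lattice_edges_def using k k2 uv True
        by (intro CollectI exI[of _ u] exI[of _ k]) (auto simp: mult.commute)
      then show ?thesis by (cases "m = 7 * n") (simp_all only: if_True if_False insert_iff simp_thms)
    next
      case False
      then have "u * 7 \<le> u * k" using pos by (intro mult_left_mono) auto
      then have "u * 7 \<le> v" using k by simp
      moreover have "n \<le> u" "v \<le> m" using uv by auto
      ultimately have "u = n" "m = 7 * n" "v = m" using nm by linarith+
      then show ?thesis by simp
    qed
  qed
  have "edges (divisor_graph n m) \<subseteq> ?E"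
  proof
    fix e assume "e \<in> edges (divisor_graph n m)"
    then obtain u v where uv: "e = {u, v}" "u \<in> {n..m}" "v \<in> {n..m}" "u \<noteq> v" "u dvd v \<or> v dvd u"
      unfolding divisor_graph_def graph.simps by blast
    have "{u, v} = {v, u}" by (rule insert_commute)
    then show "e \<in> ?E" using key[of u v] key[of v u] uv by metis
  qed
  moreover have "lattice_edges n m \<subseteq> edges (divisor_graph n m)"
  proof
    fix e assume "e \<in> lattice_edges n m"
    then obtain u k where e: "e = {u, k * u}" "n \<le> u" "2 \<le> k" "k * u \<le> m"
      by (auto simp: lattice_edges_def)
    have "1 * u < k * u" using e n by (intro mult_strict_right_mono) auto
    then have "u < k * u" by (simp only: mult_1)
    then show "e \<in> edges (divisor_graph n m)"
      unfolding divisor_graph_def graph.simps e(1) using e(2,4)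
      by (intro CollectI exI[of _ u] exI[of _ "k * u"]) auto
  qed
  moreover have "{n, m} \<in> edges (divisor_graph n m)" if "m = 7 * n"
    unfolding divisor_graph_def graph.simps using that n
    by (intro CollectI exI[of _ n] exI[of _ m]) auto
  ultimately have "edges (divisor_graph n m) = ?E" by auto
  then show ?thesis by (simp add: divisor_graph_def)
qed

lemma planar_divisor_graph:
  assumes "0 < n" "n \<le> m" "m \<le> 7 * n"
  shows "planar (divisor_graph n m)"
  using divisor_graph_lattice_edges[OF assms] lattice_join_7[of n m] lattice_drawing[of n m] assms
  unfolding planar_def by auto

lemma colorable_divisor_graph:
  assumes n: "0 < n" and m: "m \<le> 7 * n"
  shows "colorable 3 (divisor_graph n m)"
proof -
  define c :: "int \<Rightarrow> nat" where "c v = (if v < 2 * n then 0 else if v < 4 * n then 1 else 2)" for v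
  have "c u \<noteq> c v" if uv: "u \<in> {n..m}" "v \<in> {n..m}" "u \<noteq> v" "u dvd v" for u v
  proof -
    obtain k where k: "v = u * k" using uv(4) by blast
    have pos: "u > 0" "v > 0" using uv n by auto
    then have "k > 0" using k by (simp add: zero_less_mult_iff)
    moreover have "k \<noteq> 1" using k uv by auto
    ultimately have "u * 2 \<le> u * k" using pos by (intro mult_left_mono) auto
    then have "2 * u \<le> v" using k by simp
    moreover have "n \<le> u" "v \<le> m" using uv by auto
    ultimately show ?thesis using m n unfolding c_def by (simp split: if_split)
  qed
  then have "\<forall>u\<in>{n..m}. \<forall>v\<in>{n..m}. adjacent (divisor_graph n m) u v \<longrightarrow> c u \<noteq> c v"
    unfolding adjacent_divisor_graph_iff by metis
  moreover have "\<forall>v. c v < 3" by (simp add: c_def)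
  ultimately show ?thesis unfolding colorable_def by auto
qed

section \<open>Non-planarity beyond ratio 7\<close>

lemma connected_in_singleton: "connected_in G {x}"
  by (simp add: connected_in_def)

lemma connected_in_Un:
  assumes X: "connected_in G X" and Y: "connected_in G Y"
    and xy: "x \<in> X" "y \<in> Y" "{x, y} \<in> edges G"
  shows "connected_in G (X \<union> Y)"
proof -
  let ?R = "\<lambda>Z. {(u, v). u \<in> Z \<and> v \<in> Z \<and> {u, v} \<in> edges G}"
  have mono: "(?R X)\<^sup>* \<subseteq> (?R (X \<union> Y))\<^sup>*" "(?R Y)\<^sup>* \<subseteq> (?R (X \<union> Y))\<^sup>*"
    by (rule rtrancl_mono; blast)+
  have "(x, y) \<in> ?R (X \<union> Y)" "(y, x) \<in> ?R (X \<union> Y)"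
    using xy by (auto simp: insert_commute)
  then have xy': "(x, y) \<in> (?R (X \<union> Y))\<^sup>*" "(y, x) \<in> (?R (X \<union> Y))\<^sup>*"
    by blast+
  have XX: "(u, v) \<in> (?R (X \<union> Y))\<^sup>*" if "u \<in> X" "v \<in> X" for u v
    using X that mono unfolding connected_in_def by blast
  have YY: "(u, v) \<in> (?R (X \<union> Y))\<^sup>*" if "u \<in> Y" "v \<in> Y" for u v
    using Y that mono unfolding connected_in_def by blast
  show ?thesis
    unfolding connected_in_def
  proof (intro ballI)
    fix u v assume "u \<in> X \<union> Y" "v \<in> X \<union> Y"
    then consider "u \<in> X" "v \<in> X" | "u \<in> Y" "v \<in> Y" | "u \<in> X" "v \<in> Y" | "u \<in> Y" "v \<in> X" by blast
    then show "(u, v) \<in> (?R (X \<union> Y))\<^sup>*"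
    proof cases
      case 3
      then show ?thesis using XX[of u x] YY[of y v] xy xy' by (meson rtrancl_trans)
    next
      case 4
      then show ?thesis using YY[of u y] XX[of x v] xy xy' by (meson rtrancl_trans)
    qed (use XX YY in auto)
  qed
qed

lemma connected_in_insert:
  assumes "connected_in G X" "x \<in> X" "{x, y} \<in> edges G"
  shows "connected_in G (insert y X)"
  using connected_in_Un[OF assms(1) connected_in_singleton assms(2) singletonI assms(3)] by simp

lemma connected_in_path:
  "successively (\<lambda>x y. {x, y} \<in> edges G) vs \<Longrightarrow> connected_in G (set vs)"
proof (induction vs)
  case Nil
  then show ?case by (simp add: connected_in_def)
next
  case (Cons x vs)
  then show ?case
  proof (cases vs)
    case Nil
    then show ?thesis by (simp add: connected_in_singleton)
  next
    case (Cons y ys)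
    then have "connected_in G (set vs)" "{y, x} \<in> edges G" "y \<in> set vs"
      using Cons.IH Cons.prems by (auto simp: insert_commute)
    then show ?thesis using connected_in_insert by fastforce
  qed
qed

lemma edge_divisor_graphI:
  assumes "n \<le> u" "u < v" "v \<le> m" "u dvd v"
  shows "{u, v} \<in> edges (divisor_graph n m)" "{v, u} \<in> edges (divisor_graph n m)"
proof -
  show "{u, v} \<in> edges (divisor_graph n m)"
    unfolding divisor_graph_def graph.simps using assms
    by (intro CollectI exI[of _ u] exI[of _ v]) auto
  then show "{v, u} \<in> edges (divisor_graph n m)" by (simp add: insert_commute)
qed

text \<open>Doubling below \<open>3 * n\<close> and dividing by 3 above it never leaves the window from \<open>n\<close> to \<open>6 * n\<close>.\<close>

lemma doubling_thirding_chain: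
  fixes y n m :: int
  assumes "0 < n" "6 * n \<le> m"
    and "n \<le> y * 3 ^ b" "y * 3 ^ b < 6 * n" "n \<le> y * 2 ^ a" "y * 2 ^ a < 6 * n"
  shows "\<exists>C. C \<subseteq> {n..<6 * n} \<inter> {y * 2 ^ i * 3 ^ j | i j. j \<le> b} \<and>
    connected_in (divisor_graph n m) C \<and> y * 3 ^ b \<in> C \<and> y * 2 ^ a \<in> C"
  using assms(3-)
proof (induction "a + b" arbitrary: a b y)
  case 0
  then show ?case
    by (intro exI[of _ "{y}"]) (auto simp: connected_in_singleton intro!: exI[of _ 0])
next
  case (Suc k)
  let ?T = "\<lambda>y b. {n..<6 * n} \<inter> {y * 2 ^ i * 3 ^ j | i j. j \<le> b}"
  have start: "y * 3 ^ b \<in> ?T y b"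
    using Suc.prems by (intro IntI CollectI exI[of _ 0] exI[of _ b]) auto
  show ?case
  proof (cases "y * 3 ^ b < 3 * n")
    case True
    \<comment> \<open>A doubling is left whenever one is called for: otherwise
      \<open>y \<ge> n\<close>, and the remaining factors 3 would put \<open>y * 3 ^ b\<close> at
      \<open>3 * n\<close> or above. In the other case, without factors 3,
      \<open>y \<ge> 3 * n\<close> and the remaining doublings would overshoot
      \<open>6 * n\<close>.\<close>
    have "a \<noteq> 0"
    proof
      assume a: "a = 0"
      then obtain b' where b: "b = Suc b'" using Suc.hyps(2) by (cases b) auto
      have "y \<ge> n" "n > 0" using a Suc.prems assms(1) by auto
      then have "n * 3 * 1 \<le> y * 3 * 3 ^ b'"
        by (intro mult_mono) auto
      then show False using True b by (simp add: mult.assoc)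
    qed
    then obtain a' where a: "a = Suc a'" by (cases a) auto
    obtain C where C: "C \<subseteq> ?T (2 * y) b" "connected_in (divisor_graph n m) C"
        "2 * y * 3 ^ b \<in> C" "2 * y * 2 ^ a' \<in> C"
      using Suc.hyps(1)[of a' b "2 * y"] Suc.hyps(2) Suc.prems True a assms(1)
      by (auto simp: mult_ac)
    have "{2 * y * 3 ^ b, y * 3 ^ b} \<in> edges (divisor_graph n m)"
      using Suc.prems True assms(1,2) by (intro edge_divisor_graphI) auto
    then have "connected_in (divisor_graph n m) (insert (y * 3 ^ b) C)"
      using C by (intro connected_in_insert)
    moreover have "?T (2 * y) b \<subseteq> ?T y b"
    proof -
      have "2 * y * 2 ^ i * 3 ^ j = y * 2 ^ Suc i * 3 ^ j" for i j by simp
      then show ?thesis by blast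
    qed
    moreover have "y * 2 ^ a \<in> C" using C(4) a by (simp add: mult_ac)
    ultimately show ?thesis
      using C start by (intro exI[of _ "insert (y * 3 ^ b) C"]) auto
  next
    case False
    have "b \<noteq> 0"
    proof
      assume b: "b = 0"
      then obtain a' where a: "a = Suc a'" using Suc.hyps(2) by (cases a) auto
      have "y \<ge> 3 * n" "n > 0" using b False assms(1) by auto
      then have "3 * n * 2 * 1 \<le> y * 2 * 2 ^ a'"
        by (intro mult_mono) auto
      then show False using Suc.prems a by (simp add: mult.assoc)
    qed
    then obtain b' where b: "b = Suc b'" by (cases b) auto
    obtain C where C: "C \<subseteq> ?T y b'" "connected_in (divisor_graph n m) C"
        "y * 3 ^ b' \<in> C" "y * 2 ^ a \<in> C"
      using Suc.hyps(1)[of a b' y] Suc.hyps(2) Suc.prems False b assms(1)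
      by (auto simp: mult_ac)
    have "{y * 3 ^ b', y * 3 ^ b} \<in> edges (divisor_graph n m)"
      using Suc.prems False assms(1,2) b by (intro edge_divisor_graphI) auto
    then have "connected_in (divisor_graph n m) (insert (y * 3 ^ b) C)"
      using C by (intro connected_in_insert)
    moreover have "?T y b' \<subseteq> ?T y b"
      using b by (auto intro: le_SucI)
    ultimately show ?thesis
      using C start by (intro exI[of _ "insert (y * 3 ^ b) C"]) auto
  qed
qed

section \<open>Powers of 2 slightly above powers of 3\<close>

lemma log_2_3_irrational: "log 2 3 \<notin> \<rat>"
proof
  assume "log 2 3 \<in> \<rat>"
  then obtain i j :: int where ij: "log 2 3 = i / j" "j > 0"
    by (metis Rats_cases')
  have "log 2 3 > (0::real)" by simp
  then have "i > 0" using ij by (simp add: zero_less_divide_iff)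
  then obtain p q :: nat where pq: "i = int p" "j = int q" "p > 0" "q > 0"
    using ij by (metis pos_int_cases)
  have "real q * log 2 3 = real p" using ij pq by simp
  then have "log 2 (3 ^ q) = real p" by (simp add: log_nat_power)
  moreover have "2 powr log 2 (3 ^ q) = (3::real) ^ q" by (rule powr_log_cancel) auto
  ultimately have "(3::real) ^ q = 2 ^ p" by (simp add: powr_realpow)
  then have "real (3 ^ q) = real (2 ^ p)" by simp
  then have "(3::nat) ^ q = 2 ^ p" by (rule of_nat_eq_iff[THEN iffD1])
  moreover have "even ((2::nat) ^ p)" using pq by simp
  moreover have "odd ((3::nat) ^ q)" by simp
  ultimately show False by metis
qed

text \<open>By Kronecker, some \<open>k * log 2 3\<close> has fractional part within
  \<open>log 2 t\<close> of 1. Rounding it up to \<open>a\<close> adds a small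
  \<open>\<delta>\<close>, positive because a fractional part is below 1, and
  \<open>2 ^ a / 3 ^ k = 2 powr \<delta>\<close>.\<close>

lemma power_2_just_above_power_3:
  assumes "(1::real) < t"
  obtains a b :: nat where "0 < b" "(3::int) ^ b < 2 ^ a" "(2::real) ^ a < t * 3 ^ b"
proof -
  define \<epsilon> where "\<epsilon> = log 2 t"
  have "\<epsilon> > 0" using assms by (simp add: \<epsilon>_def)
  then obtain k where k: "k > 0" "\<bar>frac (real k * log 2 3) - 1\<bar> < \<epsilon>"
    using Kronecker_approx_1_explicit[OF log_2_3_irrational, of 1 \<epsilon>] by auto
  define \<delta> where "\<delta> = 1 - frac (real k * log 2 3)"
  have \<delta>: "0 < \<delta>" "\<delta> < \<epsilon>"
    using k frac_lt_1[of "real k * log 2 3"] by (auto simp: \<delta>_def)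
  define a where "a = nat (\<lfloor>real k * log 2 3\<rfloor> + 1)"
  have "0 \<le> real k * log 2 3" by simp
  then have "\<lfloor>real k * log 2 3\<rfloor> \<ge> 0" by (simp only: zero_le_floor)
  then have "real a = real_of_int \<lfloor>real k * log 2 3\<rfloor> + 1" by (simp add: a_def)
  then have a: "real a = log 2 3 * real k + \<delta>"
    by (simp add: \<delta>_def frac_def mult.commute)
  have "(2::real) ^ a = 2 powr real a" by (simp add: powr_realpow)
  also have "\<dots> = (2 powr log 2 3) powr real k * 2 powr \<delta>"
    unfolding a by (simp only: powr_add powr_powr)
  also have "\<dots> = 3 ^ k * 2 powr \<delta>" by (simp add: powr_realpow)
  finally have eq: "(2::real) ^ a = 3 ^ k * 2 powr \<delta>" .
  have "2 powr \<delta> < t"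
    using \<delta>(2) assms by (simp add: \<epsilon>_def less_log_iff)
  then have "(2::real) ^ a < t * 3 ^ k" using eq by simp
  moreover have "(1::real) < 2 powr \<delta>" using \<delta> by simp
  then have "(3::real) ^ k < 2 ^ a" using eq by simp
  then have "(3::int) ^ k < 2 ^ a" by (metis of_int_less_iff of_int_numeral of_int_power)
  ultimately show thesis using that k by blast
qed

text \<open>
  In units of \<open>n\<close>, the poles are \<open>6/5\<close> and \<open>4/3\<close>; two of the paths between them run through
  \<open>1\<close> and \<open>16/15\<close>, and \<open>V3\<close> joins the poles around the other side. The hub \<open>V4\<close> contains
  \<open>t = 2 ^ a / 3 ^ b\<close>, from which three chains lead back along \<open>7 * t\<close>, \<open>6 * t / 5\<close> and \<open>5 * t\<close>
  to the neighbours of \<open>1\<close>, \<open>16/15\<close> and \<open>10/3\<close>.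
\<close>

lemma not_planar_divisor_graph:
  fixes a b :: nat and m :: int
  assumes b: "0 < b" and lower: "(3::int) ^ b < 2 ^ a" and upper: "5 * (2::int) ^ a < 6 * 3 ^ b"
    and m: "280 * 2 ^ a \<le> m"
  shows "\<not> planar (divisor_graph (40 * 3 ^ b) m)"
proof -
  \<comment> \<open>No power of 2 lies strictly between 3 and 18/5. Having \<open>b \<ge> 2\<close>
    and \<open>a \<ge> 4\<close> allows 9 and 16 to be split off, as in \<open>n = 360 * q\<close>
    and \<open>48 * 2 ^ a = 768 * 2 ^ a'\<close>.\<close>
  have "b \<noteq> 1"
  proof
    assume "b = 1"
    then have "(2::int) ^ a = 2 ^ 2 \<or> a < 2 \<or> 2 < a" "3 < (2::int) ^ a" "5 * (2::int) ^ a < 18"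
      using lower upper by auto
    moreover have "(2::int) ^ a \<le> 2 ^ 1" if "a < 2" using that by (intro power_increasing) auto
    moreover have "(2::int) ^ 3 \<le> 2 ^ a" if "2 < a" using that by (intro power_increasing) auto
    ultimately show False by auto
  qed
  then obtain e where e: "b = e + 2" using b by (metis One_nat_def add_2_eq_Suc' less_numeral_extra(3) not0_implies_Suc)
  have "\<not> a < 4"
  proof
    assume "a < 4"
    then have "(2::int) ^ a \<le> 2 ^ 3" by (intro power_increasing) auto
    moreover have "(3::int) ^ 2 \<le> 3 ^ b" using e by (intro power_increasing) auto
    ultimately show False using lower by simp
  qed
  then obtain a' where a: "a = a' + 4" by (metis add.commute le_Suc_ex not_less)
  define q :: int where "q = 3 ^ e"
  define n where "n = 40 * (3::int) ^ b"
  define x :: int where "x = 40 * 2 ^ a"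
  have q: "q > 0" by (simp add: q_def)
  have n: "n = 360 * q" by (simp add: n_def q_def e)
  have nx: "n < x" "5 * x < 6 * n" "7 * x \<le> m"
    using lower upper m by (auto simp: n_def x_def)
  have n0: "0 < n" "7 * n \<le> m" using n q nx by auto
  let ?G = "divisor_graph n m"
  \<comment> \<open>Separates the hub from the rest: the cycle and \<open>V3\<close> lie inside,
    \<open>V4\<close> outside. In \<open>V4\<close>, the set \<open>C7\<close>, \<open>7 * x\<close>
    and \<open>2520 * q\<close> have the factor 7, \<open>C1\<close> and \<open>6 * x\<close> have
    256, while \<open>C5\<close> and \<open>x\<close> have too few factors 3.\<close>
  define S where "S = {v. \<not> 7 dvd v \<and> \<not> 256 dvd v \<and> 3 * q dvd v}"
  have S: "c * q \<in> S" if "\<not> 7 dvd c" "\<not> 256 dvd c" "3 dvd c" for c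
  proof -
    have "coprime (7::int) q" "coprime (256::int) q"
    proof -
      show "coprime (7::int) q"
        unfolding q_def by (intro coprime_power_right_iff[THEN iffD2] disjI1 primes_coprime) auto
      have "coprime ((2::int) ^ 8) q"
        unfolding q_def by (intro coprime_power_right_iff[THEN iffD2] coprime_power_left_iff[THEN iffD2]
          disjI1 primes_coprime) auto
      then show "coprime (256::int) q" by simp
    qed
    then show ?thesis
      using that by (simp add: S_def coprime_dvd_mult_left_iff mult_dvd_mono)
  qed
  have E: "{c * q, d * q} \<in> edges ?G"
    if "360 \<le> c" "c \<le> 2520" "360 \<le> d" "d \<le> 2520" "c < d \<and> c dvd d \<or> d < c \<and> d dvd c" for c d
  proof -
    have "n \<le> c * q" "n \<le> d * q" "c * q \<le> 2520 * q" "d * q \<le> 2520 * q"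
      unfolding n using that q by (auto intro: mult_right_mono)
    moreover have "2520 * q \<le> m" using n0 n by simp
    moreover have "c * q < d * q \<longleftrightarrow> c < d" "d * q < c * q \<longleftrightarrow> d < c"
      using q by (auto simp: mult_less_cancel_right)
    ultimately show ?thesis
      using that(5) edge_divisor_graphI[of n "c * q" "d * q" m] edge_divisor_graphI[of n "d * q" "c * q" m]
      by (auto intro: mult_dvd_mono)
  qed
  \<comment> \<open>A walk from \<open>1296 = 3 * 432\<close> to \<open>2400 = 5 * 480\<close>,
    neighbours of the two poles, passing 1200, where the hub is attached.\<close>
  define U3 :: "int list" where
    "U3 = [1296, 648, 1944, 486, 2430, 810, 405, 2025, 675, 1350, 450, 1800, 600, 1200, 2400]"
  define V3 where "V3 = (\<lambda>c. c * q) ` set U3"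
  have V3: "connected_in ?G V3"
  proof -
    have "successively (\<lambda>x y. {x, y} \<in> edges ?G) (map (\<lambda>c. c * q) U3)"
      unfolding U3_def by (simp add: E)
    from connected_in_path[OF this] show ?thesis by (simp add: V3_def)
  qed
  \<comment> \<open>The chains connect the halves of \<open>7 * n\<close> and \<open>7 * x\<close>;
    the double of \<open>384 * q\<close> and a fifth of \<open>6 * x\<close>; a third of
    \<open>1200 * q\<close> and \<open>5 * x\<close>.\<close>
  obtain C7 where C7: "C7 \<subseteq> {n..<6 * n} \<inter> {140 * 2 ^ i * 3 ^ j | i j. j \<le> b}"
      "connected_in ?G C7" "1260 * q \<in> C7" "140 * 2 ^ a \<in> C7"
    using doubling_thirding_chain[of n m 140 b a] n0 nx n q
    by (auto simp: q_def e x_def power_add)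
  obtain C1 where C1: "C1 \<subseteq> {n..<6 * n} \<inter> {768 * 2 ^ i * 3 ^ j | i j. j \<le> e}"
      "connected_in ?G C1" "768 * q \<in> C1" "48 * 2 ^ a \<in> C1"
    using doubling_thirding_chain[of n m 768 e a'] n0 nx n q
    by (auto simp: q_def a x_def power_add)
  obtain C5 where C5: "C5 \<subseteq> {n..<6 * n} \<inter> {400 * 2 ^ i * 3 ^ j | i j. j \<le> e}"
      "connected_in ?G C5" "400 * q \<in> C5" "5 * x \<in> C5"
    using doubling_thirding_chain[of n m 400 e "a' + 3"] n0 nx n q
    by (auto simp: q_def a x_def power_add)
  define V4 where "V4 = insert (6 * x) (insert x (insert (7 * x) (insert (2520 * q) C7))) \<union> C1 \<union> C5"
  have V4: "connected_in ?G V4"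
  proof -
    have x140: "140 * 2 ^ a < 7 * x" "140 * 2 ^ a dvd 7 * x" "n \<le> 140 * 2 ^ a"
      and x48: "48 * 2 ^ a < 6 * x" "48 * 2 ^ a dvd 6 * x" "n \<le> 48 * 2 ^ a"
      using nx n0 by (auto simp: x_def)
    have e7: "{140 * 2 ^ a, 7 * x} \<in> edges ?G"
      using x140 nx by (intro edge_divisor_graphI(1))
    have e7': "{7 * x, x} \<in> edges ?G"
      using nx n0 by (intro edge_divisor_graphI(2)) auto
    have e6: "{x, 6 * x} \<in> edges ?G" and e5: "{x, 5 * x} \<in> edges ?G"
      using nx n0 by (auto intro!: edge_divisor_graphI(1))
    have e6': "{6 * x, 48 * 2 ^ a} \<in> edges ?G"
      using x48 nx n0 by (intro edge_divisor_graphI(2)) auto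
    have 1: "connected_in ?G (insert (2520 * q) C7)"
      by (rule connected_in_insert[OF C7(2,3) E]) auto
    have 2: "connected_in ?G (insert (7 * x) (insert (2520 * q) C7))"
      by (rule connected_in_insert[OF 1 _ e7]) (use C7 in blast)
    have 3: "connected_in ?G (insert x (insert (7 * x) (insert (2520 * q) C7)))"
      by (rule connected_in_insert[OF 2 _ e7']) blast
    have 4: "connected_in ?G (insert (6 * x) (insert x (insert (7 * x) (insert (2520 * q) C7))))"
      by (rule connected_in_insert[OF 3 _ e6]) blast
    have 5: "connected_in ?G (insert (6 * x) (insert x (insert (7 * x) (insert (2520 * q) C7))) \<union> C1)"
      by (rule connected_in_Un[OF 4 C1(2) _ C1(4) e6']) blast
    show ?thesis
      unfolding V4_def by (rule connected_in_Un[OF 5 C5(2) _ C5(4) e5]) blast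
  qed
  have V4m: "V4 \<subseteq> {n..m}"
    using C1 C5 C7 nx n0 n by (auto simp: V4_def)
  have V4S: "V4 \<inter> S = {}"
  proof -
    have three: "\<not> 3 dvd (2::int) ^ k" for k
      using prime_dvd_power[of "3::int" 2 k] by auto
    have "7 dvd v" if "v \<in> C7" for v
      using that C7(1) by (auto intro!: dvd_mult2)
    moreover have "256 dvd v" if "v \<in> C1" for v
      using that C1(1) by (auto intro!: dvd_mult2)
    moreover have "\<not> 3 * q dvd v" if vC: "v \<in> C5" for v
    proof
      assume d: "3 * q dvd v"
      obtain i j where v: "v = 400 * 2 ^ i * 3 ^ j" "j \<le> e" using vC C5(1) by blast
      obtain l where l: "e = j + l" using v(2) le_Suc_ex by blast
      have "3 * 3 ^ j dvd v" using d by (auto simp: q_def l power_add intro: dvd_trans[rotated])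
      then have "3 dvd (400 * 2 ^ i :: int)" by (simp add: v(1))
      then show False
        by (simp add: prime_dvd_mult_iff three)
    qed
    moreover have "256 dvd 6 * x" by (simp add: x_def a power_add)
    moreover have "\<not> 3 * q dvd x"
    proof
      assume "3 * q dvd x"
      then have "3 dvd x" by (rule dvd_trans[rotated]) simp
      then show False
        by (simp add: x_def prime_dvd_mult_iff three)
    qed
    ultimately show ?thesis unfolding V4_def S_def by auto
  qed
  have V3S: "V3 \<subseteq> S"
    unfolding V3_def U3_def by (auto intro!: S)
  \<comment> \<open>Between the poles \<open>432 * q\<close> and \<open>480 * q\<close>,
    neighbouring entries have quotients 5, 6, 4, 3 on the first arc and, starting from
    \<open>480 * q\<close>, 4, 5, 3, 2, 3, 4 on the second.\<close>
  let ?xs = "[2160 * q, 360 * q, 1440 * q]" and ?ys = "[1920 * q, 384 * q, 1152 * q, 576 * q, 1728 * q]"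
  have cycleS: "set (432 * q # 480 * q # ?xs @ ?ys) \<subseteq> S"
    by (auto intro!: S)
  have False if dr: "plane_drawing ?G p \<gamma>" for p \<gamma>
  proof (rule no_theta_with_hub[OF dr simple_graph_divisor_graph,
        where u = "432 * q" and h = "480 * q" and xs = ?xs and ys = ?ys and ?b1.0 = "360 * q" and ?b2.0 = "384 * q"
          and v = "1296 * q" and v' = "2400 * q" and ?V3.0 = V3 and ?V4.0 = V4])
    show "distinct (432 * q # ?xs @ [480 * q])" "distinct (480 * q # ?ys @ [432 * q])"
      "set ?xs \<inter> set ?ys = {}"
      using q by auto
    show "successively (\<lambda>x y. {x, y} \<in> edges ?G) (432 * q # ?xs @ [480 * q])"
      "successively (\<lambda>x y. {x, y} \<in> edges ?G) (480 * q # ?ys @ [432 * q])"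
      by (simp_all add: E)
    show "360 * q \<in> set ?xs" "384 * q \<in> set ?ys" by auto
    show "{432 * q, 480 * q} \<notin> edges ?G"
    proof
      assume "{432 * q, 480 * q} \<in> edges ?G"
      then have "432 * q dvd 480 * q \<or> 480 * q dvd 432 * q"
        using adjacent_divisor_graph_iff[of n m "432 * q" "480 * q"] by (simp add: adjacent_def)
      then show False using q by simp
    qed
    show "connected_in ?G V3" by (rule V3)
    show "finite V3" by (simp add: V3_def)
    show "{1296 * q, 432 * q} \<in> edges ?G" "{2400 * q, 480 * q} \<in> edges ?G" by (simp_all add: E)
    show "1296 * q \<in> V3" "2400 * q \<in> V3" by (auto simp: V3_def U3_def)
    show "V4 \<noteq> {}" by (simp add: V4_def)
    show "connected_in ?G (insert (360 * q) V4)"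
      by (rule connected_in_insert[OF V4 _ E[of 2520]]) (auto simp: V4_def)
    show "connected_in ?G (insert (384 * q) V4)"
      by (rule connected_in_insert[OF V4 _ E[of 768]]) (use C1 in \<open>auto simp: V4_def\<close>)
    show "connected_in ?G (V3 \<union> V4)"
      by (rule connected_in_Un[OF V3 V4 _ _ E[of 1200 400]])
        (use C5 in \<open>auto simp: V4_def V3_def U3_def\<close>)
    show "V3 \<inter> V4 = {}" using V3S V4S by blast
    show "(V3 \<union> V4) \<inter> set (432 * q # 480 * q # ?xs @ ?ys) = {}"
    proof -
      have "V3 \<inter> set (432 * q # 480 * q # ?xs @ ?ys) = {}"
        using q by (auto simp: V3_def U3_def)
      then show ?thesis using V4S cycleS by blast
    qed
    show "set (432 * q # 480 * q # ?xs @ ?ys) \<subseteq> verts ?G"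
      using n0 n q by auto
    show "V3 \<subseteq> verts ?G"
      using n0 n q by (auto simp: V3_def U3_def)
    show "V4 \<subseteq> verts ?G" using V4m by simp
  qed
  then show ?thesis unfolding planar_def n_def by blast
qed


text \<open>For \<open>t = 2 ^ a / 3 ^ b\<close>, the bound \<open>t < s / 7\<close> makes
  \<open>7 * 40 * 2 ^ a\<close> fit below \<open>s * 40 * 3 ^ b\<close>, and
  \<open>t < 6 / 5\<close> leaves room for the chains.\<close>

lemma divisor_graph_planar_ratio_le_7:
  fixes s :: real
  assumes planar: "\<And>n :: int. 0 < n \<Longrightarrow> planar (divisor_graph n \<lfloor>s * real_of_int n\<rfloor>)"
  shows "s \<le> 7"
proof (rule ccontr)
  assume "\<not> s \<le> 7"
  then have "1 < min (s / 7) (6 / 5)" by simp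
  then obtain a b :: nat where ab: "0 < b" "(3::int) ^ b < 2 ^ a"
      "(2::real) ^ a < min (s / 7) (6 / 5) * 3 ^ b"
    by (rule power_2_just_above_power_3)
  have "(2::real) ^ a < 6 / 5 * 3 ^ b"
    using ab(3) by (rule less_le_trans) (intro mult_right_mono; simp)
  then have "real_of_int (5 * 2 ^ a) < real_of_int (6 * 3 ^ b)" by simp
  then have upper: "5 * (2::int) ^ a < 6 * 3 ^ b" by (simp only: of_int_less_iff)
  have "(2::real) ^ a < s / 7 * 3 ^ b"
    using ab(3) by (rule less_le_trans) (intro mult_right_mono; simp)
  then have "280 * 2 ^ a \<le> \<lfloor>s * real_of_int (40 * 3 ^ b)\<rfloor>"
    by (simp add: le_floor_iff)
  from not_planar_divisor_graph[OF ab(1,2) upper this] planar[of "40 * 3 ^ b"]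
  show False by simp
qed

theorem mainTheorem1:
  "(\<forall>n m :: int. 0 < n \<and> n \<le> m \<and> m \<le> 7 * n \<longrightarrow>
      planar (divisor_graph n m) \<and> colorable 3 (divisor_graph n m)) \<and>
   (7 :: real) \<in> {r :: real. \<forall>n :: int. 0 < n \<longrightarrow> planar (divisor_graph n \<lfloor>r * real_of_int n\<rfloor>)} \<and>
   (\<forall>s \<in> {r :: real. \<forall>n :: int. 0 < n \<longrightarrow> planar (divisor_graph n \<lfloor>r * real_of_int n\<rfloor>)}. s \<le> 7)"
proof (intro conjI)
  show "\<forall>n m :: int. 0 < n \<and> n \<le> m \<and> m \<le> 7 * n \<longrightarrow>
      planar (divisor_graph n m) \<and> colorable 3 (divisor_graph n m)"
    using planar_divisor_graph colorable_divisor_graph by blast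
  have "planar (divisor_graph n \<lfloor>7 * real_of_int n\<rfloor>)" if "0 < n" for n
  proof -
    have "\<lfloor>7 * real_of_int n\<rfloor> = \<lfloor>real_of_int (7 * n)\<rfloor>" by simp
    also have "\<dots> = 7 * n" by (rule floor_of_int)
    finally show ?thesis using that planar_divisor_graph[of n "7 * n"] by simp
  qed
  then show "(7 :: real) \<in> {r :: real. \<forall>n :: int. 0 < n \<longrightarrow> planar (divisor_graph n \<lfloor>r * real_of_int n\<rfloor>)}"
    by blast
  show "\<forall>s \<in> {r :: real. \<forall>n :: int. 0 < n \<longrightarrow> planar (divisor_graph n \<lfloor>r * real_of_int n\<rfloor>)}. s \<le> 7"
    using divisor_graph_planar_ratio_le_7 by blast
qed

end
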